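(* Let $f_1,\dots,f_n$ be monotone linear functions (i.e. $\alpha(f_i)>0$ for all $i$). Then: (i) $f_1,\dots,f_n$ are colinear if and only if every permutation $\sigma:[n]\to[n]$ is minimum. (ii) If $f_1,\dots,f_n$ are not colinear, then the following are equivalent: (ii-1) $f_1,\dots,f_n$ are potentially identical; (ii-2) a permutation is minimum if and only if it is counterclockwise. (iii) If $f_1,\dots,f_n$ are neither colinear nor potentially identical, then a permutation $\sigma$ is minimum if and only if $\sigma$ is counterclockwise and $\theta(f^\sigma)+\pi\in[\theta(f_{\sigma(t)}),\theta(f_{\sigma(s)})]_{2\pi}$, where $s$ and $t$ are respectively the smallest and the largest index $i\in[n]$ such that $f_{\sigma(i)}$ is non-identical.
   Context: A linear function is $f:\mathbb{R}\to\mathbb{R}$, $f(x)=ax+b$ with $a,b\in\mathbb{R}$; write $\alpha(f)=a$, $\beta(f)=b$. $f$ is monotone (increasing) if $a>0$, constant if $a=0$, monotone decreasing if $a<0$, nondecreasing if $a\ge 0$, and identical if $f(x)=x$. The vector of $f$ is $\vec f=(b,\,1-a)^\top\in\mathbb{R}^2$; the angle $\theta(f)\in[0,2\pi)$ is the polar angle of $\vec f$, with $\theta(f)=\bot$ if $\vec f=0$ (i.e. $f$ is identical). For $\theta_1,\theta_2\in\mathbb{R}$ write $\theta_1=_{2\pi}\theta_2$ if $\theta_1-\theta_2\in2\pi\mathbb{Z}$, and $[\theta_1,\theta_2]_{2\pi}=\{\theta\in[\lambda_1,\lambda_2]\mid \lambda_1=_{2\pi}\theta_1,\ \lambda_2=_{2\pi}\theta_2,\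 \lambda_2-\lambda_1\in[0,2\pi)\}$ (open and half-open versions analogously); membership of an angle (possibly outside $[0,2\pi)$) in such a set is thus taken modulo $2\pi$. For functions, $g\le h$ (resp. $g<h$) means $g(x)\le h(x)$ (resp. $<$) for all $x$. For linear functions $f_1,\dots,f_n$ and a permutation $\sigma$ of $[n]=\{1,\dots,n\}$, $f^\sigma=f_{\sigma(n)}\circ\cdots\circ f_{\sigma(1)}$. $\sigma$ is minimum (optimal) if $f^\sigma\le f^\rho$ for every permutation $\rho$, and maximum if $f^\sigma\ge f^\rho$ for every $\rho$. $\sigma$ is counterclockwise if, after discarding the positions $i$ with $f_{\sigma(i)}$ identical, there is $k$ such that $\theta(f_{\sigma(k)})\le\cdots\le\theta(f_{\sigma(n)})\le\theta(f_{\sigma(1)})\le\cdots\le\theta(f_{\sigma(k-1)})$ (i.e. the remaining sequence of angles becomes nondecreasing after a cyclic rotation). $f_1,\dots,f_n$ are colinear if there is $\lambda$ with $\theta(f_i)\in\{\lambda,\lambda+\pi\}_{2\pi}\cup\{\bot\}$ for all $i$, and potentially identical if some counterclockwise permutation $\sigma$ satisfies $f^\sigma(x)=x$. *)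

theory Defs
  imports "HOL-Analysis.Analysis" "HOL-Combinatorics.Permutations"
begin

text \<open>A linear function f(x) = a x + b is represented by the pair (a, b).\<close>
type_synonym linfun = "real \<times> real"

definition lf_alpha :: "linfun \<Rightarrow> real" where "lf_alpha f = fst f"
definition lf_beta :: "linfun \<Rightarrow> real" where "lf_beta f = snd f"

definition lf_app :: "linfun \<Rightarrow> real \<Rightarrow> real" where
  "lf_app f x = lf_alpha f * x + lf_beta f"

definition lf_identical :: "linfun \<Rightarrow> bool" where
  "lf_identical f \<longleftrightarrow> (\<forall>x. lf_app f x = x)"

definition lf_comp :: "linfun \<Rightarrow> linfun \<Rightarrow> linfun" where
  "lf_comp g f = (lf_alpha g * lf_alpha f, lf_alpha g * lf_beta f + lf_beta g)"

fun comp_seq :: "(nat \<Rightarrow> linfun) \<Rightarrow> nat \<Rightarrow> linfun" where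
  "comp_seq h 0 = (1, 0)"
| "comp_seq h (Suc k) = lf_comp (h (Suc k)) (comp_seq h k)"

definition perm_comp :: "(nat \<Rightarrow> linfun) \<Rightarrow> nat \<Rightarrow> (nat \<Rightarrow> nat) \<Rightarrow> linfun" where
  "perm_comp f n \<sigma> = comp_seq (\<lambda>i. f (\<sigma> i)) n"

definition lf_vec :: "linfun \<Rightarrow> complex" where
  "lf_vec f = Complex (lf_beta f) (1 - lf_alpha f)"

text \<open>polar angle in [0,2pi); None plays the role of bottom (f identical)\<close>
definition lf_theta :: "linfun \<Rightarrow> real option" where
  "lf_theta f = (if lf_vec f = 0 then None else Some (Arg2pi (lf_vec f)))"

definition eq2pi :: "real \<Rightarrow> real \<Rightarrow> bool" where
  "eq2pi x y \<longleftrightarrow> (\<exists>m::int. x - y = 2 * pi * of_int m)"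

definition arc2pi :: "real \<Rightarrow> real \<Rightarrow> real set" where
  "arc2pi th1 th2 = {th. \<exists>l1 l2 l. eq2pi l1 th1 \<and> eq2pi l2 th2 \<and> 0 \<le> l2 - l1 \<and> l2 - l1 < 2 * pi
                          \<and> eq2pi l th \<and> l1 \<le> l \<and> l \<le> l2}"

definition is_minimum :: "(nat \<Rightarrow> linfun) \<Rightarrow> nat \<Rightarrow> (nat \<Rightarrow> nat) \<Rightarrow> bool" where
  "is_minimum f n \<sigma> \<longleftrightarrow>
     (\<forall>\<rho>. \<rho> permutes {1..n} \<longrightarrow> (\<forall>x. lf_app (perm_comp f n \<sigma>) x \<le> lf_app (perm_comp f n \<rho>) x))"

definition angle_list :: "(nat \<Rightarrow> linfun) \<Rightarrow> nat \<Rightarrow> (nat \<Rightarrow> nat) \<Rightarrow> real list" where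
  "angle_list f n \<sigma> = map (\<lambda>i. the (lf_theta (f (\<sigma> i))))
                        (filter (\<lambda>i. \<not> lf_identical (f (\<sigma> i))) [1..<Suc n])"

definition counterclockwise :: "(nat \<Rightarrow> linfun) \<Rightarrow> nat \<Rightarrow> (nat \<Rightarrow> nat) \<Rightarrow> bool" where
  "counterclockwise f n \<sigma> \<longleftrightarrow> (\<exists>k. sorted (rotate k (angle_list f n \<sigma>)))"

definition colinear :: "(nat \<Rightarrow> linfun) \<Rightarrow> nat \<Rightarrow> bool" where
  "colinear f n \<longleftrightarrow> (\<exists>lam. \<forall>i\<in>{1..n}. lf_theta (f i) = None \<or>
        (\<exists>th. lf_theta (f i) = Some th \<and> (eq2pi th lam \<or> eq2pi th (lam + pi))))"

definition potentially_identical :: "(nat \<Rightarrow> linfun) \<Rightarrow> nat \<Rightarrow> bool" where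
  "potentially_identical f n \<longleftrightarrow>
     (\<exists>\<sigma>. \<sigma> permutes {1..n} \<and> counterclockwise f n \<sigma> \<and> (\<forall>x. lf_app (perm_comp f n \<sigma>) x = x))"

end

theory Submission
  imports Defs
begin

text \<open>
  Exchanging two consecutive blocks X, Y of a composition changes it by a positive multiple of the
  determinant of their vectors, so in a minimum order every block makes a turn in [0, pi] with the
  next one. Let w be the vector of the whole composition. Applied to prefixes, this inequality says
  that every prefix has a nonnegative determinant with w; combined with the inequality for
  neighbours (through the Pluecker relation) it shows that a minimum order never crosses the
  direction -w, i.e. it is sorted by the angle relative to -w. If w = 0 the same argument is applied
  after removing the last function. Conversely, functions with equal angles commute, so all
  counterclockwise orders are, up to such ties, rotations of a single sorted list, and an order whose
  first and last angles enclose -w is at least as good as each of its rotations.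
\<close>

section \<open>The determinant of two linear functions\<close>

text \<open>The cross product of the vectors of \<open>f\<close> and \<open>g\<close>: positive iff
  the turn from \<open>f\<close> to \<open>g\<close> lies strictly between 0 and pi.\<close>

definition lf_det :: "linfun \<Rightarrow> linfun \<Rightarrow> real" where
  "lf_det f g = snd f * (1 - fst g) - (1 - fst f) * snd g"

lemma lf_comp_simps [simp]:
  "fst (lf_comp g f) = fst g * fst f"
  "snd (lf_comp g f) = fst g * snd f + snd g"
  by (simp_all add: lf_comp_def lf_alpha_def lf_beta_def)

lemma lf_comp_id [simp]: "lf_comp f (1, 0) = f" "lf_comp (1, 0) f = f"
  by (simp_all add: prod_eq_iff)

lemma lf_comp_assoc: "lf_comp (lf_comp f g) h = lf_comp f (lf_comp g h)"
  by (simp add: prod_eq_iff algebra_simps)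

lemma lf_identical_iff: "lf_identical f \<longleftrightarrow> f = (1, 0)"
proof
  assume "lf_identical f"
  then have "lf_app f 0 = 0" "lf_app f 1 = 1"
    by (simp_all add: lf_identical_def)
  then show "f = (1, 0)"
    by (simp add: lf_app_def lf_alpha_def lf_beta_def prod_eq_iff)
qed (simp add: lf_identical_def lf_app_def lf_alpha_def lf_beta_def)

lemma lf_det_self [simp]: "lf_det f f = 0"
  by (simp add: lf_det_def)

lemma lf_det_id [simp]: "lf_det (1, 0) f = 0" "lf_det f (1, 0) = 0"
  by (simp_all add: lf_det_def)

lemma lf_det_swap: "lf_det g f = - lf_det f g"
  by (simp add: lf_det_def)

text \<open>The vector of \<open>lf_comp g f\<close> is that of \<open>g\<close> plus
  \<open>fst g\<close> times that of \<open>f\<close>, and the determinant is bilinear.\<close>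

lemma lf_det_comp_left: "lf_det (lf_comp g f) h = lf_det g h + fst g * lf_det f h"
  by (simp add: lf_det_def algebra_simps)

lemma lf_det_comp_right: "lf_det h (lf_comp g f) = lf_det h g + fst g * lf_det h f"
  by (simp add: lf_det_def algebra_simps)

text \<open>Both compositions have the same slope, so this is their whole difference.\<close>

lemma lf_det_commutator: "snd (lf_comp f g) - snd (lf_comp g f) = lf_det f g"
  by (simp add: lf_det_def algebra_simps)

lemma lf_comp_commute: "lf_det f g = 0 \<Longrightarrow> lf_comp f g = lf_comp g f"
  using lf_det_commutator[of f g] by (simp add: prod_eq_iff)

text \<open>The Pluecker relation for four vectors of the plane.\<close>

lemma lf_det_pluecker:
  "lf_det a b * lf_det c d = lf_det a c * lf_det b d - lf_det a d * lf_det b c"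
  by (simp add: lf_det_def algebra_simps)

text \<open>A vector parallel to the nonzero vector \<open>w\<close> is a multiple \<open>p\<close>
  of it; \<open>p\<close> is read off at a nonzero coordinate of \<open>w\<close>.\<close>

lemma parallel_scale:
  assumes "w \<noteq> (1, 0)" "lf_det v w = 0"
  obtains p where "\<And>u. lf_det v u = p * lf_det w u"
proof (cases "snd w = 0")
  case True
  then have 1: "fst w \<noteq> 1" using assms(1) by (auto simp: prod_eq_iff)
  with True assms(2) have 2: "snd v = 0" by (simp add: lf_det_def)
  show ?thesis
    by (rule that[of "(1 - fst v) / (1 - fst w)"]) (use 1 2 True in \<open>simp_all add: lf_det_def\<close>)
next
  case False
  define p where "p = snd v / snd w"
  have 1: "snd v = p * snd w" using False by (simp add: p_def)
  have 2: "1 - fst v = p * (1 - fst w)"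
    using False assms(2) by (simp add: p_def lf_det_def field_simps)
  have "lf_det v u = p * lf_det w u" for u
    unfolding lf_det_def 1 2 by (simp add: algebra_simps)
  then show ?thesis using that by blast
qed

lemma parallel_trans:
  assumes "w \<noteq> (1, 0)" "lf_det v w = 0" "lf_det w u = 0"
  shows "lf_det v u = 0"
  using parallel_scale[OF assms(1,2)] assms(3) by (metis mult_zero_right)

text \<open>Only the zero vector is parallel to two independent vectors.\<close>

lemma lf_det_eq_0_imp_id:
  assumes "lf_det p x = 0" "lf_det p y = 0" "lf_det x y \<noteq> 0"
  shows "p = (1, 0)"
proof (rule ccontr)
  assume "p \<noteq> (1, 0)"
  then have "lf_det x y = 0"
    using parallel_trans[of p x y] assms(1,2) lf_det_swap[of p x] by simp
  with assms(3) show False by simp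
qed

section \<open>Compositions along lists\<close>

text \<open>The head of the list is applied first, so a permutation is read from position 1
  upwards.\<close>

primrec lcomp :: "linfun list \<Rightarrow> linfun" where
  "lcomp [] = (1, 0)"
| "lcomp (x # xs) = lf_comp (lcomp xs) x"

lemma lcomp_append [simp]: "lcomp (xs @ ys) = lf_comp (lcomp ys) (lcomp xs)"
  by (induction xs) (simp_all add: lf_comp_assoc)

abbreviation pos_slopes :: "linfun list \<Rightarrow> bool" where
  "pos_slopes xs \<equiv> \<forall>x\<in>set xs. 0 < fst x"

lemma fst_lcomp_pos: "pos_slopes xs \<Longrightarrow> 0 < fst (lcomp xs)"
  by (induction xs) simp_all

text \<open>The slope ignores the order; hence comparing rearrangements pointwise amounts to
  comparing intercepts.\<close>

lemma fst_lcomp: "fst (lcomp xs) = prod_mset (image_mset fst (mset xs))"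
  by (induction xs) (simp_all add: mult.commute)

lemma lf_det_lcomp_eq_0:
  "\<forall>x\<in>set xs. lf_det x u = 0 \<Longrightarrow> lf_det (lcomp xs) u = 0"
  by (induction xs) (simp_all add: lf_det_comp_left)

text \<open>With positive slopes the vector of a composition is a positive combination of the
  vectors of its members.\<close>

lemma lf_det_lcomp_nonneg:
  "pos_slopes xs \<Longrightarrow> \<forall>x\<in>set xs. 0 \<le> lf_det x u \<Longrightarrow> 0 \<le> lf_det (lcomp xs) u"
  by (induction xs) (simp_all add: lf_det_comp_left fst_lcomp_pos less_imp_le)

lemma lf_det_lcomp_nonpos:
  "pos_slopes xs \<Longrightarrow> \<forall>x\<in>set xs. lf_det x u \<le> 0 \<Longrightarrow> lf_det (lcomp xs) u \<le> 0"
  by (induction xs)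
    (auto simp: lf_det_comp_left intro!: add_nonpos_nonpos mult_nonneg_nonpos less_imp_le[OF fst_lcomp_pos])

section \<open>Minimum orders of a list and the exchange of blocks\<close>

definition lmin :: "linfun list \<Rightarrow> bool" where
  "lmin xs \<longleftrightarrow> (\<forall>ys. mset ys = mset xs \<longrightarrow> snd (lcomp xs) \<le> snd (lcomp ys))"

lemma lmin_eq:
  assumes "lmin xs" "mset ys = mset xs" "lcomp ys = lcomp xs"
  shows "lmin ys"
  using assms by (simp add: lmin_def)

lemma lmin_exists: "\<exists>ys. mset ys = mset xs \<and> lmin ys"
proof -
  have fin: "finite {ys. mset ys = mset xs}"
    by (rule mset_eq_finite)
  let ?A = "(\<lambda>ys. snd (lcomp ys)) ` {ys. mset ys = mset xs}"
  have "Min ?A \<in> ?A" using fin by (intro Min_in) auto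
  then obtain ys where ys: "mset ys = mset xs" "snd (lcomp ys) = Min ?A" by auto
  have "lmin ys" unfolding lmin_def
    using ys fin by (auto intro!: Min_le)
  with ys show ?thesis by blast
qed

text \<open>A better order of \<open>X\<close> would have the same slope and a smaller intercept,
  and the increasing \<open>B\<close> would pass the gain on.\<close>

lemma lmin_infix:
  assumes "lmin (A @ X @ B)" "pos_slopes B"
  shows "lmin X"
  unfolding lmin_def
proof (intro allI impI)
  fix Y assume Y: "mset Y = mset X"
  have "fst (lcomp Y) = fst (lcomp X)" using Y by (simp add: fst_lcomp)
  moreover have "snd (lcomp (A @ X @ B)) \<le> snd (lcomp (A @ Y @ B))"
    using assms(1) Y unfolding lmin_def by (metis mset_append)
  ultimately have "fst (lcomp B) * snd (lcomp X) \<le> fst (lcomp B) * snd (lcomp Y)"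
    by (simp add: algebra_simps)
  then show "snd (lcomp X) \<le> snd (lcomp Y)"
    using fst_lcomp_pos[OF assms(2)] by simp
qed

text \<open>The block \<open>X @ Y\<close> is itself minimum, so it is no worse than
  \<open>Y @ X\<close>; the commutator formula gives the sign.\<close>

lemma lmin_exchange:
  assumes "lmin (A @ X @ Y @ B)" "pos_slopes B"
  shows "0 \<le> lf_det (lcomp X) (lcomp Y)"
proof -
  have "lmin (X @ Y)" using lmin_infix[of A "X @ Y" B] assms by simp
  then have "snd (lcomp (X @ Y)) \<le> snd (lcomp (Y @ X))"
    unfolding lmin_def by (simp del: lcomp_append)
  then show ?thesis
    using lf_det_commutator[of "lcomp X" "lcomp Y"] by simp
qed

lemma lmin_commute:
  assumes "lmin (A @ X @ Y @ B)" "lf_det (lcomp X) (lcomp Y) = 0"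
  shows "lmin (A @ Y @ X @ B)"
proof (rule lmin_eq[OF assms(1)])
  show "lcomp (A @ Y @ X @ B) = lcomp (A @ X @ Y @ B)"
    using lf_comp_commute[OF assms(2)] by (simp flip: lf_comp_assoc) (simp add: lf_comp_assoc)
qed simp

definition noncolinear :: "linfun list \<Rightarrow> bool" where
  "noncolinear xs \<longleftrightarrow> (\<exists>x\<in>set xs. \<exists>y\<in>set xs. lf_det x y \<noteq> 0)"

section \<open>Angles\<close>

text \<open>A total version of \<open>lf_theta\<close>, with value 0 at the identical
  function.\<close>

definition angle :: "linfun \<Rightarrow> real" where
  "angle f = Arg2pi (lf_vec f)"

text \<open>The angle \<open>x\<close> measured counterclockwise from the direction
  \<open>\<phi>\<close>, again in [0, 2 pi) when both angles are.\<close>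

definition turn :: "real \<Rightarrow> real \<Rightarrow> real" where
  "turn \<phi> x = (if \<phi> \<le> x then x - \<phi> else x - \<phi> + 2 * pi)"

definition anti :: "linfun \<Rightarrow> real" where
  "anti f = Arg2pi (- lf_vec f)"

lemma lf_vec_eq_0_iff: "lf_vec f = 0 \<longleftrightarrow> f = (1, 0)"
  by (auto simp: lf_vec_def lf_alpha_def lf_beta_def complex_eq_iff prod_eq_iff)

lemma angle_bounds: "0 \<le> angle f" "angle f < 2 * pi"
  by (simp_all add: angle_def Arg2pi_ge_0 Arg2pi_lt_2pi)

lemma anti_bounds: "0 \<le> anti f" "anti f < 2 * pi"
  by (simp_all add: anti_def Arg2pi_ge_0 Arg2pi_lt_2pi)

lemma turn_bounds:
  assumes "0 \<le> \<phi>" "\<phi> < 2 * pi" "0 \<le> x" "x < 2 * pi"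
  shows "0 \<le> turn \<phi> x" "turn \<phi> x < 2 * pi"
  using assms by (auto simp: turn_def)

lemma lf_det_sin:
  "lf_det f g = cmod (lf_vec f) * cmod (lf_vec g) * sin (angle g - angle f)"
proof -
  have "lf_det f g = Re (lf_vec f) * Im (lf_vec g) - Im (lf_vec f) * Re (lf_vec g)"
    by (simp add: lf_det_def lf_vec_def lf_alpha_def lf_beta_def)
  then show ?thesis
    unfolding cos_Arg2pi[symmetric] sin_Arg2pi[symmetric] angle_def
    by (simp add: sin_diff algebra_simps)
qed

text \<open>Passing from \<open>w\<close> to its opposite shifts the angle by pi, which reverses the
  sign of the sine.\<close>

lemma lf_det_anti:
  "lf_det f w = cmod (lf_vec f) * cmod (lf_vec w) * sin (angle f - anti w)"
proof -
  have "lf_det f w = Im (lf_vec f) * Re (- lf_vec w) - Re (lf_vec f) * Im (- lf_vec w)"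
    by (simp add: lf_det_def lf_vec_def lf_alpha_def lf_beta_def algebra_simps)
  then show ?thesis
    unfolding cos_Arg2pi[symmetric] sin_Arg2pi[symmetric] angle_def anti_def
    by (simp add: sin_diff algebra_simps)
qed

lemma sin_turn [simp]: "sin (turn \<phi> x) = sin (x - \<phi>)"
  by (simp add: turn_def)

lemma sin_turn_diff: "sin (turn \<phi> y - turn \<phi> x) = sin (y - x)"
proof -
  have "\<exists>k::int. turn \<phi> y - turn \<phi> x = (y - x) + of_int k * (2 * pi)"
  proof -
    have "turn \<phi> y - turn \<phi> x \<in> {y - x, y - x + 2 * pi, y - x - 2 * pi}" by (auto simp: turn_def)
    then show ?thesis
      by (auto intro: exI[of _ 0] exI[of _ 1] exI[of _ "-1"])
  qed
  then obtain k :: int where "turn \<phi> y - turn \<phi> x = (y - x) + of_int k * (2 * pi)" by blast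
  then show ?thesis
    using sin.plus_of_int[of "y - x" k] by (simp add: mult.commute)
qed

text \<open>Parallel vectors with different angles are opposite; \<open>c\<close> is the quotient of
  their lengths.\<close>

lemma parallel_cases:
  assumes "x \<noteq> (1, 0)" "y \<noteq> (1, 0)" "lf_det x y = 0" "angle x \<noteq> angle y"
  obtains c where "c > 0" "\<And>z. lf_det y z = - c * lf_det x z"
proof -
  have n: "cmod (lf_vec x) > 0" "cmod (lf_vec y) > 0"
    using assms(1,2) by (simp_all add: lf_vec_eq_0_iff)
  then have "sin (angle y - angle x) = 0"
    using assms(3) lf_det_sin[of x y] by simp
  then obtain i :: int where i: "angle y - angle x = of_int i * pi"
    by (auto simp: sin_zero_iff_int2)
  have "\<bar>of_int i * pi\<bar> < 2 * pi"
    using i angle_bounds[of x] angle_bounds[of y] by linarith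
  then have "\<bar>of_int i :: real\<bar> < 2" by (simp add: abs_mult)
  then have "\<bar>i\<bar> < 2" by linarith
  moreover have "i \<noteq> 0" using i assms(4) by auto
  ultimately have "i = 1 \<or> i = -1" by linarith
  then have d: "angle y = angle x + pi \<or> angle y = angle x - pi"
    using i by auto
  have e: "sin (angle z - angle y) = - sin (angle z - angle x)" for z
    using d by (auto simp: sin_diff sin_add cos_diff cos_add)
  show ?thesis
  proof (rule that[of "cmod (lf_vec y) / cmod (lf_vec x)"])
    fix z show "lf_det y z = - (cmod (lf_vec y) / cmod (lf_vec x)) * lf_det x z"
      unfolding lf_det_sin[of y z] lf_det_sin[of x z] e using n by simp
  qed (use n in simp)
qed

section \<open>Minimum orders are counterclockwise\<close>

lemma lmin_prefix:
  assumes "lmin (X @ Y)"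
  shows "0 \<le> lf_det (lcomp X) (lcomp (X @ Y))"
  using lmin_exchange[of "[]" X Y "[]"] assms by (simp add: lf_det_comp_right)

text \<open>Two antiparallel neighbours commute with each other and with everything parallel to them, so
  either of them can be moved next to the nearest non-parallel function; the exchange inequality
  then holds with both signs.\<close>

lemma lmin_neighbours:
  assumes min: "lmin (A @ x # y # B)" and inc: "pos_slopes (A @ x # y # B)"
    and nonid: "(1, 0) \<notin> set (A @ x # y # B)" and nc: "noncolinear (A @ x # y # B)"
  shows "0 < lf_det x y \<or> angle x = angle y"
proof (rule ccontr)
  assume H: "\<not> ?thesis"
  have xy: "x \<noteq> (1, 0)" "y \<noteq> (1, 0)" using nonid by auto
  have min1: "lmin (A @ [x] @ [y] @ B)" using min by simp
  have "0 \<le> lf_det x y"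
    using lmin_exchange[OF min1] inc by simp
  with H have D: "lf_det x y = 0" by auto
  with H xy obtain c where c: "c > 0" "\<And>z. lf_det y z = - c * lf_det x z"
    using parallel_cases[of x y] by blast
  have min2: "lmin (A @ [y] @ [x] @ B)"
    using lmin_commute[OF min1] D by simp
  have "\<exists>z\<in>set A \<union> set B. lf_det x z \<noteq> 0"
  proof (rule ccontr)
    assume "\<not> ?thesis"
    then have "lf_det x z = 0" if "z \<in> set (A @ x # y # B)" for z
      using that D by auto
    then have "lf_det u v = 0" if "u \<in> set (A @ x # y # B)" "v \<in> set (A @ x # y # B)" for u v
      using that parallel_trans[OF xy(1), of u v] lf_det_swap[of x u] by simp
    with nc show False unfolding noncolinear_def by blast
  qed
  then consider "\<exists>z\<in>set B. lf_det x z \<noteq> 0" | "\<exists>z\<in>set A. lf_det x z \<noteq> 0" by blast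
  then show False
  proof cases
    case 1
    then obtain Q z R where B: "B = Q @ z # R" "lf_det x z \<noteq> 0" "\<forall>q\<in>set Q. \<not> lf_det x q \<noteq> 0"
      using split_list_first_prop[of B "\<lambda>z. lf_det x z \<noteq> 0"] by blast
    have q: "lf_det (lcomp [x]) (lcomp Q) = 0" "lf_det (lcomp [y]) (lcomp Q) = 0"
      using lf_det_lcomp_eq_0[of Q x] B(3) lf_det_swap[of "lcomp Q" x] lf_det_swap[of _ x] c(2)
      by simp_all
    have "lmin ((A @ [y]) @ Q @ [x] @ z # R)"
      by (rule lmin_commute) (use min2 B q in simp_all)
    then have "0 \<le> lf_det x z"
      using lmin_exchange[of "A @ [y] @ Q" "[x]" "[z]" R] inc B by simp
    moreover have "lmin ((A @ [x]) @ Q @ [y] @ z # R)"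
      by (rule lmin_commute) (use min1 B q in simp_all)
    then have "0 \<le> lf_det y z"
      using lmin_exchange[of "A @ [x] @ Q" "[y]" "[z]" R] inc B by simp
    ultimately show False using c B(2) by (simp add: mult_le_0_iff)
  next
    case 2
    then obtain R z Q where A: "A = R @ z # Q" "lf_det x z \<noteq> 0" "\<forall>q\<in>set Q. \<not> lf_det x q \<noteq> 0"
      using split_list_last_prop[of A "\<lambda>z. lf_det x z \<noteq> 0"] by blast
    have q: "lf_det (lcomp Q) (lcomp [x]) = 0" "lf_det (lcomp Q) (lcomp [y]) = 0"
      using lf_det_lcomp_eq_0[of Q x] A(3) lf_det_swap[of "lcomp Q" x] lf_det_swap[of _ x]
        lf_det_swap[of "lcomp Q" y] c(2)
      by simp_all
    have "lmin ((R @ [z]) @ [x] @ Q @ y # B)"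
      by (rule lmin_commute) (use min1 A q in simp_all)
    then have "0 \<le> lf_det z x"
      using lmin_exchange[of "R" "[z]" "[x]" "Q @ y # B"] inc A by auto
    moreover have "lmin ((R @ [z]) @ [y] @ Q @ x # B)"
      by (rule lmin_commute) (use min2 A q in simp_all)
    then have "0 \<le> lf_det z y"
      using lmin_exchange[of "R" "[z]" "[y]" "Q @ x # B"] inc A by auto
    ultimately have "lf_det x z \<le> 0" "c * lf_det x z \<ge> 0"
      using c(2)[of z] lf_det_swap[of x z] lf_det_swap[of y z] by simp_all
    then show False using c(1) A(2) by (simp add: zero_le_mult_iff)
  qed
qed

text \<open>Here \<open>x\<close> lies before and \<open>y\<close> after the direction -w. With
  \<open>P\<close> the prefix ending in \<open>x\<close>, the Pluecker relation writes 0 as a sum of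
  three nonnegative terms, so all vanish and \<open>P\<close> is parallel to both \<open>x\<close>
  and \<open>y\<close>, hence identical.\<close>

lemma lmin_no_crossing:
  assumes min: "lmin (A @ x # y # B)" and inc: "pos_slopes (A @ x # y # B)"
    and w: "w = lcomp (A @ x # y # B)"
    and d: "0 < lf_det x y" "lf_det x w < 0" "0 < lf_det y w"
  shows False
proof -
  define P where "P = lcomp (A @ [x])"
  have Py: "0 \<le> lf_det P y"
    unfolding P_def using lmin_exchange[of "[]" "A @ [x]" "[y]" B] min inc by simp
  have "0 \<le> lf_det (lcomp A) x"
    using lmin_exchange[of "[]" A "[x]" "y # B"] min inc by auto
  then have Px: "0 \<le> lf_det P x"
    unfolding P_def using inc by (simp add: lf_det_comp_left)
  have Pw: "0 \<le> lf_det P w"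
    unfolding P_def w using lmin_prefix[of "A @ [x]" "y # B"] min by simp
  have pl: "lf_det x y * lf_det P w + lf_det P x * lf_det y w + (- lf_det x w) * lf_det P y = 0"
    using lf_det_pluecker[of x y P w] lf_det_swap[of x P] lf_det_swap[of y P] by (simp add: algebra_simps)
  have nn: "0 \<le> lf_det x y * lf_det P w" "0 \<le> lf_det P x * lf_det y w"
    "0 \<le> (- lf_det x w) * lf_det P y"
    using d Pw Px Py by (simp_all add: mult_nonpos_nonneg)
  have "lf_det P x * lf_det y w = 0" "(- lf_det x w) * lf_det P y = 0"
    using pl nn by linarith+
  then have "lf_det P x = 0" "lf_det P y = 0" using d by auto
  with d(1) have "P = (1, 0)"
    using lf_det_eq_0_imp_id[of P x y] by simp
  \<comment> \<open>An identical prefix drops out of \<open>w\<close>, so exchanging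
    \<open>x\<close> with everything after it contradicts the sign of
    \<open>lf_det x w\<close>.\<close>
  moreover have "w = lf_comp (lcomp (y # B)) P"
    unfolding w P_def by (simp add: lf_comp_assoc)
  ultimately have "w = lcomp (y # B)" by simp
  moreover have "0 \<le> lf_det x (lcomp (y # B))"
    using lmin_exchange[of A "[x]" "y # B" "[]"] min by simp
  ultimately show False using d(2) by simp
qed

text \<open>This excludes a crossing of -w that pauses at a block \<open>Z\<close> pointing along
  -w. The prefix \<open>P\<close> before \<open>Z\<close> is forced to be a multiple
  \<open>p\<close> of \<open>w\<close>; one exchange gives p > 0, another, after moving
  \<open>Z\<close> away, denies it.\<close>

lemma lmin_no_return:
  assumes min: "lmin (A @ x # Z @ y # B)" and inc: "pos_slopes (A @ x # Z @ y # B)"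
    and w: "w = lcomp (A @ x # Z @ y # B)" and wid: "w \<noteq> (1, 0)"
    and c: "c > 0" "\<And>u. lf_det (lcomp Z) u = - c * lf_det w u"
    and d: "lf_det x w < 0" "0 < lf_det y w"
  shows False
proof -
  define P where "P = lcomp (A @ [x])"
  define S where "S = lcomp (Z @ y # B)"
  have wPS: "w = lf_comp S P"
    unfolding w P_def S_def by (simp add: lf_comp_assoc)
  have S: "0 < fst S" unfolding S_def by (rule fst_lcomp_pos) (use inc in auto)
  have minb: "lmin ([] @ (A @ [x]) @ Z @ y # B)" using min by simp
  have "lf_det P (lcomp Z) = - c * lf_det P w"
    using c(2)[of P] lf_det_swap[of P w] lf_det_swap[of P "lcomp Z"] by simp
  moreover have "0 \<le> lf_det P (lcomp Z)"
    unfolding P_def using lmin_exchange[OF minb] inc by simp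
  ultimately have "lf_det P w \<le> 0" using c(1) by (simp add: mult_le_0_iff)
  moreover have "0 \<le> lf_det P w"
    unfolding P_def w using lmin_prefix[of "A @ [x]" "Z @ y # B"] min by simp
  ultimately have Pw: "lf_det P w = 0" by simp
  then have "lf_det P (lcomp Z) = 0"
    using \<open>lf_det P (lcomp Z) = - c * lf_det P w\<close> by simp
  \<comment> \<open>\<open>Z\<close> commutes with the whole prefix, so it moves to the front and
    the prefix becomes adjacent to \<open>y\<close>.\<close>
  then have "lmin ([] @ Z @ (A @ [x]) @ y # B)"
    unfolding P_def by (rule lmin_commute[OF minb])
  then have Py: "0 \<le> lf_det P y"
    unfolding P_def using lmin_exchange[of Z "A @ [x]" "[y]" B] inc by simp
  obtain p where p: "\<And>u. lf_det P u = p * lf_det w u"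
    using parallel_scale[OF wid Pw] by blast
  have "0 \<le> lf_det x S"
    unfolding S_def using lmin_exchange[of A "[x]" "Z @ y # B" "[]"] min by simp
  \<comment> \<open>The vector of \<open>w\<close> is that of \<open>S\<close> plus
    \<open>fst S\<close> times that of \<open>P\<close>, and \<open>P\<close> is \<open>p\<close>
    times \<open>w\<close>.\<close>
  moreover have "lf_det x w = lf_det x S + fst S * (p * lf_det x w)"
  proof -
    have "lf_det x P = p * lf_det x w"
      using p[of x] lf_det_swap[of P x] lf_det_swap[of w x] by simp
    then show ?thesis
      using lf_det_comp_right[of x S P] by (simp flip: wPS)
  qed
  ultimately have "0 \<le> (1 - fst S * p) * lf_det x w" by (simp add: algebra_simps)
  with d(1) have "1 \<le> fst S * p" by (simp add: zero_le_mult_iff)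
  then have "0 < fst S * p" by simp
  with S have "0 < p" by (simp add: zero_less_mult_iff)
  then have "0 < p * lf_det y w" using d(2) by simp
  with Py p[of y] lf_det_swap[of y w] show False by simp
qed

text \<open>The angle of \<open>x\<close> counted from -w. Keys in (0, pi) mean a positive
  determinant with \<open>w\<close>, keys beyond pi a negative one.\<close>

definition key :: "linfun \<Rightarrow> linfun \<Rightarrow> real" where
  "key w x = turn (anti w) (angle x)"

lemma key_bounds: "0 \<le> key w x" "key w x < 2 * pi"
  unfolding key_def by (intro turn_bounds anti_bounds angle_bounds)+

lemma key_eq_iff: "key w x = key w y \<longleftrightarrow> angle x = angle y"
  using angle_bounds[of x] angle_bounds[of y] by (auto simp: key_def turn_def)

lemma key_eq_0_iff: "key w x = 0 \<longleftrightarrow> angle x = anti w"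
  using angle_bounds[of x] anti_bounds[of w] by (auto simp: key_def turn_def)

lemma lf_det_key: "lf_det x w = cmod (lf_vec x) * cmod (lf_vec w) * sin (key w x)"
  by (simp add: key_def lf_det_anti)

lemma lf_det_key_diff:
  "lf_det x y = cmod (lf_vec x) * cmod (lf_vec y) * sin (key w y - key w x)"
  by (simp add: key_def lf_det_sin sin_turn_diff)

lemma lf_det_key_sgn:
  assumes "x \<noteq> (1, 0)" "w \<noteq> (1, 0)"
  shows "sgn (lf_det x w) = sgn (sin (key w x))"
  using assms by (simp add: lf_det_key sgn_mult lf_vec_eq_0_iff)

text \<open>Key 0 means pointing along -w, and a composition of such functions is a positive
  combination of their vectors.\<close>

lemma key_0_scale:
  assumes "w \<noteq> (1, 0)" "Z \<noteq> []" "pos_slopes Z" "\<forall>z\<in>set Z. z \<noteq> (1, 0) \<and> key w z = 0"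
  obtains c where "c > 0" "\<And>u. lf_det (lcomp Z) u = - c * lf_det w u"
proof -
  have one: "\<exists>c>0. \<forall>u. lf_det z u = - c * lf_det w u" if "z \<noteq> (1, 0)" "key w z = 0" for z
  proof (intro exI conjI allI)
    show "cmod (lf_vec z) / cmod (lf_vec w) > 0"
      using that assms(1) by (simp add: lf_vec_eq_0_iff)
    fix u
    have "lf_det z u = cmod (lf_vec z) / cmod (lf_vec w) * lf_det u w"
      unfolding lf_det_sin[of z u] lf_det_anti[of u w] using that assms(1)
      by (simp add: key_eq_0_iff lf_vec_eq_0_iff)
    then show "lf_det z u = - (cmod (lf_vec z) / cmod (lf_vec w)) * lf_det w u"
      using lf_det_swap[of u w] by simp
  qed
  have "\<exists>c>0. \<forall>u. lf_det (lcomp Z) u = - c * lf_det w u"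
    using assms(2-)
  proof (induction Z rule: list_nonempty_induct)
    case (single z)
    then show ?case using one[of z] by simp
  next
    case (cons z Z)
    then obtain c where c: "c > 0" "\<forall>u. lf_det (lcomp Z) u = - c * lf_det w u" by auto
    obtain d where d: "d > 0" "\<forall>u. lf_det z u = - d * lf_det w u"
      using one[of z] cons.prems by auto
    have "0 < fst (lcomp Z)" using cons.prems by (intro fst_lcomp_pos) simp
    with c d show ?case
      by (intro exI[of _ "c + fst (lcomp Z) * d"])
        (simp add: lf_det_comp_left algebra_simps add_pos_pos)
  qed
  then show ?thesis using that by blast
qed

section \<open>Minimum orders are sorted by the angle from -w\<close>

lemma sorted_map_const: "\<forall>x\<in>set xs. a x = c \<Longrightarrow> sorted (map a xs)"
  by (induction xs) auto

text \<open>The value 0 also stands for a full turn, so zeros are allowed at either end. Only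
  descents to 0 are possible, and \<open>ret\<close> forbids rising again after one.\<close>

lemma sorted_then_zeros:
  fixes a :: "'a \<Rightarrow> real"
  assumes nonneg: "\<forall>x\<in>set xs. 0 \<le> a x"
    and adj: "\<And>A x y B. xs = A @ x # y # B \<Longrightarrow> a x \<le> a y \<or> a y = 0"
    and ret: "\<And>A x Z y B. \<lbrakk>xs = A @ x # Z @ y # B; Z \<noteq> []; \<forall>z\<in>set Z. a z = 0; 0 < a x; 0 < a y\<rbrakk> \<Longrightarrow> False"
  shows "\<exists>U V. xs = U @ V \<and> sorted (map a U) \<and> (\<forall>v\<in>set V. a v = 0)"
  using assms
proof (induction xs rule: rev_induct)
  case Nil
  then show ?case by simp
next
  case (snoc y xs)
  have "\<exists>U V. xs = U @ V \<and> sorted (map a U) \<and> (\<forall>v\<in>set V. a v = 0)"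
  proof (rule snoc.IH)
    show "\<forall>x\<in>set xs. 0 \<le> a x" using snoc.prems(1) by simp
    show "a x \<le> a z \<or> a z = 0" if "xs = A @ x # z # B" for A x z B
      using snoc.prems(2)[of A x z "B @ [y]"] that by simp
    show False if "xs = A @ x # Z @ z # B" "Z \<noteq> []" "\<forall>z\<in>set Z. a z = 0" "0 < a x" "0 < a z"
      for A x Z z B
      using snoc.prems(3)[of A x Z z "B @ [y]"] that by simp
  qed
  then obtain U V where UV: "xs = U @ V" "sorted (map a U)" "\<forall>v\<in>set V. a v = 0" by blast
  show ?case
  proof (cases "a y = 0")
    case True
    then show ?thesis
      using UV by (intro exI[of _ U] exI[of _ "V @ [y]"]) auto
  next
    case False
    then have y: "0 < a y" using snoc.prems(1) by (simp add: less_le)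
    show ?thesis
    proof (cases U rule: rev_cases)
      case Nil
      then show ?thesis
        using UV y by (intro exI[of _ "V @ [y]"] exI[of _ "[]"]) (auto simp: sorted_append intro: sorted_map_const)
    next
      case (snoc A x)
      have le: "\<forall>u\<in>set U. a u \<le> a x" using UV(2) snoc by (auto simp: sorted_append)
      show ?thesis
      proof (cases "V = []")
        case True
        then have "a x \<le> a y"
          using snoc.prems(2)[of A x y "[]"] UV(1) snoc False by simp
        then show ?thesis
          using UV(1,2) True le by (intro exI[of _ "U @ [y]"] exI[of _ "[]"]) (force simp: sorted_append)
      next
        case False
        \<comment> \<open>Otherwise the zeros of \<open>V\<close> would lie between the positive
          values at \<open>x\<close> and \<open>y\<close>; so \<open>U\<close> consists of zeros as
          well.\<close>
        have "\<not> 0 < a x"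
          using snoc.prems(3)[of A x V y "[]"] UV snoc False y by auto
        with le have "\<forall>u\<in>set U. a u = 0"
          using snoc.prems(1) UV(1) by (force intro: antisym)
        then show ?thesis
          using UV y by (intro exI[of _ "U @ V @ [y]"] exI[of _ "[]"])
            (auto simp: sorted_append intro: sorted_map_const)
      qed
    qed
  qed
qed

text \<open>Neighbours turn by less than pi, so a decrease of the key would pass over -w, either in
  one step (\<open>lmin_no_crossing\<close>) or through functions pointing along -w
  (\<open>lmin_no_return\<close>).\<close>

lemma lmin_sorted:
  assumes min: "lmin xs" and inc: "pos_slopes xs" and nonid: "(1, 0) \<notin> set xs"
    and nc: "noncolinear xs" and wid: "lcomp xs \<noteq> (1, 0)"
  shows "\<exists>U V. xs = U @ V \<and> sorted (map (key (lcomp xs)) U) \<and> (\<forall>v\<in>set V. key (lcomp xs) v = 0)"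
proof (rule sorted_then_zeros)
  let ?w = "lcomp xs"
  let ?a = "key ?w"
  have ni: "x \<noteq> (1, 0)" if "x \<in> set xs" for x using that nonid by auto
  have nb: "0 < sin (?a y - ?a x) \<or> ?a x = ?a y" if "xs = A @ x # y # B" for A x y B
  proof -
    have "0 < lf_det x y \<or> angle x = angle y"
      using lmin_neighbours[of A x y B] min inc nonid nc that by simp
    moreover have "0 < cmod (lf_vec x) * cmod (lf_vec y)"
      using ni[of x] ni[of y] that by (simp add: lf_vec_eq_0_iff)
    ultimately show ?thesis
      unfolding lf_det_key_diff[of x y ?w] key_eq_iff by (metis zero_less_mult_pos)
  qed
  have neg: "lf_det x ?w < 0" if "x \<in> set xs" "pi < ?a x" for x
    using lf_det_key_sgn[OF ni[OF that(1)] wid] sin_lt_zero[of "?a x"] that key_bounds[of ?w x]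
    by (simp add: sgn_if split: if_splits)
  have pos: "0 < lf_det x ?w" if "x \<in> set xs" "0 < ?a x" "?a x < pi" for x
    using lf_det_key_sgn[OF ni[OF that(1)] wid] sin_gt_zero[of "?a x"] that
    by (simp add: sgn_if split: if_splits)
  have adj: "?a x \<le> ?a y \<or> ?a y = 0 \<and> pi < ?a x" if xs: "xs = A @ x # y # B" for A x y B
  proof (rule ccontr)
    assume H: "\<not> ?thesis"
    then have "0 < sin (?a y - ?a x)" using nb[OF xs] by auto
    then have "sin (?a x - ?a y) < 0" using sin_minus[of "?a x - ?a y"] by simp
    \<comment> \<open>The difference of the keys is positive with a negative sine, so it exceeds pi
      and puts \<open>x\<close> and \<open>y\<close> on opposite sides of -w.\<close>
    then have gap: "pi < ?a x - ?a y"
      using sin_ge_zero[of "?a x - ?a y"] H by linarith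
    then have "pi < ?a x" "?a y < pi" "0 < ?a y"
      using H key_bounds[of ?w x] key_bounds[of ?w y] by linarith+
    then have "lf_det x ?w < 0" "0 < lf_det y ?w"
      using neg pos xs by simp_all
    moreover have "0 < lf_det x y"
      using lmin_neighbours[of A x y B] min inc nonid nc xs gap
      by (auto simp flip: key_eq_iff[of ?w])
    ultimately show False
      using lmin_no_crossing[of A x y B ?w] min inc xs by simp
  qed
  show "\<forall>x\<in>set xs. 0 \<le> ?a x" by (simp add: key_bounds)
  show "?a x \<le> ?a y \<or> ?a y = 0" if "xs = A @ x # y # B" for A x y B
    using adj[OF that] by blast
  show False
    if xs: "xs = A @ x # Z @ y # B" and Z: "Z \<noteq> []" "\<forall>z\<in>set Z. ?a z = 0"
      and x: "0 < ?a x" and y: "0 < ?a y" for A x Z y B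
  proof -
    obtain z Z1 where Z1: "Z = z # Z1" using Z(1) by (cases Z) auto
    have "pi < ?a x"
      using adj[of A x z "Z1 @ y # B"] xs Z1 Z(2) x by auto
    then have dx: "lf_det x ?w < 0" using neg xs by simp
    obtain z' Z2 where Z2: "Z = Z2 @ [z']" using Z(1) by (cases Z rule: rev_cases) auto
    \<comment> \<open>The last member of \<open>Z\<close> has key 0, so the turn from it to
      \<open>y\<close> is the key of \<open>y\<close> itself.\<close>
    have "0 < sin (?a y)"
      using nb[of "A @ x # Z2" z' y B] xs Z2 Z(2) y by auto
    then have "0 < lf_det y ?w"
      using lf_det_key_sgn[of y ?w] ni[of y] wid xs by (simp add: sgn_if split: if_splits)
    moreover obtain c where "c > 0" "\<And>u. lf_det (lcomp Z) u = - c * lf_det ?w u"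
      using key_0_scale[OF wid Z(1)] inc ni xs Z(2) by auto
    ultimately show False
      using lmin_no_return[of A x Z y B ?w c] min inc xs wid dx by simp
  qed
qed

section \<open>Cyclically sorted lists\<close>

definition cycsorted :: "real list \<Rightarrow> bool" where
  "cycsorted xs \<longleftrightarrow> (\<exists>k. sorted (rotate k xs))"

lemma cycsortedE:
  assumes "cycsorted (map a xs)"
  obtains X Y where "xs = Y @ X" "sorted (map a (X @ Y))"
proof -
  obtain k where k: "sorted (map a (rotate k xs))"
    using assms by (auto simp: cycsorted_def rotate_map)
  let ?m = "k mod length xs"
  have "rotate k xs = drop ?m xs @ take ?m xs" by (rule rotate_drop_take)
  with k show ?thesis
    using that[of "take ?m xs" "drop ?m xs"] by simp
qed

lemma cycsorted_append_swap: "cycsorted (xs @ ys) \<Longrightarrow> cycsorted (ys @ xs)"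
proof -
  assume "cycsorted (xs @ ys)"
  then obtain k where "sorted (rotate k (xs @ ys))" by (auto simp: cycsorted_def)
  moreover have "rotate k (xs @ ys) = rotate (k + length ys) (ys @ xs)"
    by (simp add: rotate_append flip: rotate_rotate)
  ultimately show ?thesis unfolding cycsorted_def by metis
qed

lemma sorted_imp_cycsorted: "sorted xs \<Longrightarrow> cycsorted xs"
  unfolding cycsorted_def by (rule exI[of _ 0]) simp

text \<open>Turning keeps the order on either side of \<open>\<phi>\<close> and places the angles
  below \<open>\<phi>\<close> after the others, which only rotates the sorted list.\<close>

lemma cycsorted_turn:
  assumes "cycsorted xs" "\<forall>x\<in>set xs. 0 \<le> x \<and> x < 2 * pi"
  shows "cycsorted (map (turn \<phi>) xs)"
proof -
  obtain X Y where XY: "xs = Y @ X" "sorted (X @ Y)"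
    using cycsortedE[of "\<lambda>x. x" xs] assms(1) by (metis list.map_ident)
  define E F where "E = takeWhile (\<lambda>x. x < \<phi>) (X @ Y)" and "F = dropWhile (\<lambda>x. x < \<phi>) (X @ Y)"
  have EF: "X @ Y = E @ F" by (simp add: E_def F_def)
  have s: "sorted (E @ F)" using XY EF by simp
  have E: "\<forall>x\<in>set E. x < \<phi>" by (auto simp: E_def dest: set_takeWhileD)
  have F: "\<forall>x\<in>set F. \<phi> \<le> x"
  proof (cases F)
    case (Cons z F')
    then have "\<not> z < \<phi>" unfolding F_def using hd_dropWhile[of "\<lambda>x. x < \<phi>" "X @ Y"] by force
    with s Cons show ?thesis by (auto simp: sorted_append)
  qed simp
  have "set xs = set (E @ F)" unfolding EF[symmetric] XY by auto
  then have b: "0 \<le> x \<and> x < 2 * pi" if "x \<in> set E \<union> set F" for x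
    using assms(2) that by auto
  have "sorted (map (turn \<phi>) F)"
    unfolding sorted_map
    by (rule sorted_wrt_mono_rel[of F "(\<le>)"]) (use s F in \<open>auto simp: sorted_append turn_def\<close>)
  moreover have "sorted (map (turn \<phi>) E)"
    unfolding sorted_map
    by (rule sorted_wrt_mono_rel[of E "(\<le>)"])
      (use s E in \<open>force simp: sorted_append turn_def\<close>)+
  moreover have "turn \<phi> x \<le> turn \<phi> y" if "x \<in> set F" "y \<in> set E" for x y
    using that E F b[of x] b[of y] by (auto simp: turn_def)
  ultimately have "sorted (map (turn \<phi>) (F @ E))" by (auto simp: sorted_append)
  then have "cycsorted (map (turn \<phi>) E @ map (turn \<phi>) F)"
    using sorted_imp_cycsorted cycsorted_append_swap by fastforce
  then have "cycsorted (map (turn \<phi>) X @ map (turn \<phi>) Y)"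
    using arg_cong[OF EF, of "map (turn \<phi>)"] by simp
  then show ?thesis unfolding XY using cycsorted_append_swap by simp
qed

text \<open>\<open>turn \<phi> 0\<close> is the opposite rotation, reduced to [0, 2 pi).\<close>

lemma turn_inverse:
  assumes "0 \<le> \<phi>" "\<phi> < 2 * pi" "0 \<le> x" "x < 2 * pi"
  shows "turn (turn \<phi> 0) (turn \<phi> x) = x"
  using assms by (auto simp: turn_def)

lemma cycsorted_key_iff: "cycsorted (map (key w) xs) \<longleftrightarrow> cycsorted (map angle xs)"
proof
  assume "cycsorted (map angle xs)"
  then have "cycsorted (map (turn (anti w)) (map angle xs))"
    by (rule cycsorted_turn) (auto simp: angle_bounds)
  then show "cycsorted (map (key w) xs)" by (simp add: key_def[abs_def] comp_def)
next
  assume "cycsorted (map (key w) xs)"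
  then have "cycsorted (map (turn (turn (anti w) 0)) (map (key w) xs))"
    by (rule cycsorted_turn) (auto simp: key_bounds)
  then show "cycsorted (map angle xs)"
    by (simp add: key_def comp_def turn_inverse angle_bounds anti_bounds)
qed

definition ccw :: "linfun list \<Rightarrow> bool" where
  "ccw xs \<longleftrightarrow> cycsorted (map angle xs)"

lemma ccw_append_swap: "ccw (xs @ ys) \<Longrightarrow> ccw (ys @ xs)"
  unfolding ccw_def map_append by (rule cycsorted_append_swap)

text \<open>Rotating \<open>V\<close> to the front gives a sorted list, because keys are
  nonnegative.\<close>

lemma sorted_zeros_ccw:
  assumes "sorted (map (key w) U)" "\<forall>v\<in>set V. key w v = 0"
  shows "ccw (U @ V)"
proof -
  have "sorted (map (key w) (V @ U))"
    using assms by (auto simp: sorted_append key_bounds intro: sorted_map_const)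
  then have "cycsorted (map (key w) (V @ U))" by (rule sorted_imp_cycsorted)
  then show ?thesis
    unfolding cycsorted_key_iff ccw_def[symmetric] by (rule ccw_append_swap)
qed

lemma noncolinear_mset: "mset xs = mset ys \<Longrightarrow> noncolinear xs \<longleftrightarrow> noncolinear ys"
  unfolding noncolinear_def by (metis set_mset_mset)

lemma not_noncolinear_parallel:
  assumes "w \<noteq> (1, 0)" "\<forall>x\<in>set xs. lf_det x w = 0"
  shows "\<not> noncolinear xs"
  using assms parallel_trans[OF assms(1)] lf_det_swap[of w] unfolding noncolinear_def
  by (metis neg_equal_0_iff_equal)

text \<open>If the whole composition is identical, there is no direction -w to sort by; then the
  last function \<open>v\<close> is the inverse of the rest \<open>u\<close> and points along the
  opposite of \<open>u\<close>.\<close>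

lemma lmin_ccw:
  assumes min: "lmin xs" and inc: "pos_slopes xs" and nonid: "(1, 0) \<notin> set xs"
    and nc: "noncolinear xs"
  shows "ccw xs"
proof (cases "lcomp xs = (1, 0)")
  case False
  then show ?thesis
    using lmin_sorted[OF min inc nonid nc] sorted_zeros_ccw by blast
next
  case True
  have "xs \<noteq> []" using nc by (auto simp: noncolinear_def)
  then obtain ys v where xs: "xs = ys @ [v]" by (cases xs rule: rev_cases) auto
  define u where "u = lcomp ys"
  have vu: "lf_comp v u = (1, 0)" using True by (simp add: xs u_def)
  have v: "v \<noteq> (1, 0)" "0 < fst v" using nonid inc xs by auto
  have u: "u \<noteq> (1, 0)" using vu v by auto
  have "lf_vec v = of_real (fst v) * - lf_vec u"
    using vu by (auto simp: lf_vec_def lf_alpha_def lf_beta_def complex_eq_iff prod_eq_iff algebra_simps)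
  then have av: "angle v = anti u"
    unfolding angle_def anti_def using v(2) by (simp only: Arg2pi_times_of_real)
  have dvu: "lf_det v u = 0"
    unfolding lf_det_anti by (simp add: av)
  \<comment> \<open>If \<open>ys\<close> were colinear, its members would be parallel to
    \<open>u\<close>, and so is \<open>v\<close>.\<close>
  have "noncolinear ys"
  proof (rule ccontr)
    assume H: "\<not> noncolinear ys"
    have "lf_det y u = 0" if "y \<in> set ys" for y
    proof -
      have "lf_det u y = 0"
        unfolding u_def by (rule lf_det_lcomp_eq_0) (use H that in \<open>auto simp: noncolinear_def\<close>)
      then show ?thesis using lf_det_swap[of u y] by simp
    qed
    then have "\<not> noncolinear xs"
      by (intro not_noncolinear_parallel[OF u]) (use dvu xs in auto)
    with nc show False by simp
  qed
  moreover have "lmin ys"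
    using lmin_infix[of "[]" ys "[v]"] min inc xs by simp
  ultimately obtain U V where UV: "ys = U @ V" "sorted (map (key u) U)" "\<forall>v\<in>set V. key u v = 0"
    using lmin_sorted[of ys] inc nonid u xs unfolding u_def by auto
  \<comment> \<open>\<open>v\<close> has key 0 with respect to \<open>u\<close>, so it joins the
    trailing zeros.\<close>
  have "ccw (U @ V @ [v])"
    by (rule sorted_zeros_ccw[OF UV(2)]) (use UV(3) av in \<open>auto simp: key_eq_0_iff\<close>)
  then show ?thesis by (simp add: xs UV(1))
qed

section \<open>Comparison of counterclockwise orders\<close>

text \<open>Two sorted orders differ only within ties, and tied functions commute.\<close>

lemma sorted_lcomp_eq:
  fixes a :: "linfun \<Rightarrow> real"
  assumes "sorted (map a xs)" "sorted (map a ys)" "mset xs = mset ys"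
    and tie: "\<And>x y. \<lbrakk>x \<in> set xs; y \<in> set xs; a x = a y\<rbrakk> \<Longrightarrow> lf_det x y = 0"
  shows "lcomp xs = lcomp ys"
  using assms
proof (induction xs arbitrary: ys)
  case Nil
  then show ?case by simp
next
  case (Cons x xs)
  have "x \<in> set ys" using Cons.prems(3) by (metis list.set_intros(1) set_mset_mset)
  then obtain A B where ys: "ys = A @ x # B" by (meson split_list)
  have sub: "set A \<subseteq> set (x # xs)"
    using Cons.prems(3) ys by (metis set_append set_mset_mset sup_ge1)
  \<comment> \<open>Entries preceding \<open>x\<close> in \<open>ys\<close> have value at most
    \<open>a x\<close>, and \<open>x\<close> is least in the other list, so they are tied with
    \<open>x\<close>.\<close>
  have "lf_det u x = 0" if "u \<in> set A" for u
  proof (rule Cons.prems(4))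
    have "a u \<le> a x" using Cons.prems(2) that ys by (auto simp: sorted_append)
    moreover have "a x \<le> a u" using Cons.prems(1) that sub by auto
    ultimately show "a u = a x" by simp
  qed (use that sub in auto)
  then have "lf_det (lcomp A) x = 0" by (intro lf_det_lcomp_eq_0) simp
  then have "lcomp ys = lcomp (x # A @ B)"
    using lf_comp_commute[of "lcomp A" x] by (simp add: ys lf_comp_assoc)
  moreover have "lcomp xs = lcomp (A @ B)"
    by (rule Cons.IH) (use Cons.prems ys in \<open>auto simp: sorted_append\<close>)
  ultimately show ?case by simp
qed

lemma angle_eq_lf_det: "angle x = angle y \<Longrightarrow> lf_det x y = 0"
  by (simp add: lf_det_sin)

text \<open>A one-sided inverse is two-sided; so a composition being identical survives
  rotation.\<close>

lemma lcomp_swap_id: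
  assumes "lcomp (X @ Y) = (1, 0)" "pos_slopes X" "pos_slopes Y"
  shows "lcomp (Y @ X) = (1, 0)"
proof -
  have "lf_det (lcomp X) (lcomp (X @ Y)) = 0" by (simp only: assms(1) lf_det_id)
  then have "lf_det (lcomp X) (lcomp Y) = 0" by (simp add: lf_det_comp_right)
  then show ?thesis using assms(1) lf_comp_commute[of "lcomp X" "lcomp Y"] by simp
qed

text \<open>Both lists are rotations of sorted lists with a common composition, so one identical
  counterclockwise order makes all of them identical.\<close>

lemma ccw_id_unique:
  assumes "ccw xs" "ccw ys" "mset xs = mset ys" "pos_slopes xs" "lcomp xs = (1, 0)"
  shows "lcomp ys = (1, 0)"
proof -
  obtain X Y where X: "xs = Y @ X" "sorted (map angle (X @ Y))"
    using assms(1) unfolding ccw_def by (rule cycsortedE)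
  obtain V W where V: "ys = W @ V" "sorted (map angle (V @ W))"
    using assms(2) unfolding ccw_def by (rule cycsortedE)
  have inc: "pos_slopes ys" using assms(3,4) by (metis set_mset_mset)
  have "lcomp (X @ Y) = (1, 0)"
    using lcomp_swap_id[of Y X] assms(4,5) X(1) by simp
  moreover have "lcomp (X @ Y) = lcomp (V @ W)"
    by (rule sorted_lcomp_eq[OF X(2) V(2)]) (use assms(3) X V angle_eq_lf_det in \<open>auto simp: ac_simps\<close>)
  ultimately show ?thesis
    using lcomp_swap_id[of V W] inc V(1) by simp
qed

lemma ccw_id_lmin:
  assumes "ccw xs" "pos_slopes xs" "(1, 0) \<notin> set xs" "noncolinear xs" "lcomp xs = (1, 0)"
  shows "lmin xs"
proof -
  obtain ys where ys: "mset ys = mset xs" "lmin ys" using lmin_exists by blast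
  then have "set ys = set xs" by (metis set_mset_mset)
  then have "ccw ys"
    using lmin_ccw[OF ys(2)] assms noncolinear_mset[OF ys(1)] by simp
  then have "lcomp ys = lcomp xs"
    using ccw_id_unique[OF assms(1)] ys(1) assms by simp
  then show ?thesis using lmin_eq[OF ys(2)] ys(1) by simp
qed

text \<open>Every rotation would be minimum too, so exchange at each cut holds in both directions.
  Then all prefixes are parallel to the whole, hence so are the single functions.\<close>

lemma lmin_nonid_not_all_ccw:
  assumes "lmin xs" "pos_slopes xs" "noncolinear xs" "lcomp xs \<noteq> (1, 0)"
    and all: "\<And>ys. \<lbrakk>mset ys = mset xs; ccw ys\<rbrakk> \<Longrightarrow> lmin ys" and "ccw xs"
  shows False
proof -
  let ?w = "lcomp xs"
  have pre: "lf_det (lcomp X) ?w = 0" if "xs = X @ Y" for X Y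
  proof -
    have "lmin (Y @ X)"
      using all[of "Y @ X"] ccw_append_swap[of X Y] assms(6) that by simp
    then have "0 \<le> lf_det (lcomp Y) (lcomp X)"
      using lmin_exchange[of "[]" Y X "[]"] by simp
    moreover have "0 \<le> lf_det (lcomp X) (lcomp Y)"
      using lmin_exchange[of "[]" X Y "[]"] assms(1) that by simp
    ultimately show ?thesis
      using lf_det_swap[of "lcomp X" "lcomp Y"] that by (simp add: lf_det_comp_right)
  qed
  have "lf_det x ?w = 0" if x: "x \<in> set xs" for x
  proof -
    obtain X Y where xs: "xs = X @ x # Y" using split_list[OF x] by blast
    then have "lf_det (lf_comp x (lcomp X)) ?w = 0" using pre[of "X @ [x]" Y] by simp
    then show ?thesis using pre[of X "x # Y"] xs by (simp add: lf_det_comp_left)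
  qed
  then show False
    using not_noncolinear_parallel[OF assms(4)] assms(3) by blast
qed

text \<open>If the last key is nonzero, the whole list is sorted; equal keys at its ends would then
  make all keys equal and the list colinear.\<close>

lemma lmin_hd_last:
  assumes "lmin xs" "pos_slopes xs" "(1, 0) \<notin> set xs" "noncolinear xs" "lcomp xs \<noteq> (1, 0)"
  shows "key (lcomp xs) (last xs) = 0 \<or> key (lcomp xs) (hd xs) < key (lcomp xs) (last xs)"
proof (rule ccontr)
  let ?a = "key (lcomp xs)"
  assume H: "\<not> ?thesis"
  obtain U V where UV: "xs = U @ V" "sorted (map ?a U)" "\<forall>v\<in>set V. ?a v = 0"
    using lmin_sorted[OF assms] by blast
  have ne: "xs \<noteq> []" using assms(4) by (auto simp: noncolinear_def)
  have "V = []"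
    using H UV(1,3) by (metis last_appendR last_in_set)
  then have s: "sorted (map ?a xs)" using UV by simp
  have b: "?a (hd xs) \<le> ?a x \<and> ?a x \<le> ?a (last xs)" if "x \<in> set xs" for x
  proof
    show "?a (hd xs) \<le> ?a x" using s that by (cases xs) auto
    show "?a x \<le> ?a (last xs)" using s that by (cases xs rule: rev_cases) (auto simp: sorted_append)
  qed
  have "?a x = ?a (hd xs)" if "x \<in> set xs" for x
    using H b[OF that] by linarith
  then have "lf_det x y = 0" if "x \<in> set xs" "y \<in> set xs" for x y
    using that angle_eq_lf_det key_eq_iff by metis
  with assms(4) show False by (auto simp: noncolinear_def)
qed

text \<open>The end condition forces the cyclic order to be cut at -w. Determinants with
  \<open>w\<close> are then first nonnegative, later nonpositive, and add up (with positive weights)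
  to \<open>lf_det w w\<close>, which is 0.\<close>

lemma ccw_prefix_nonneg:
  assumes ccw: "ccw xs" and inc: "pos_slopes xs" and w: "w = lcomp xs"
    and hl: "key w (last xs) = 0 \<or> key w (hd xs) < key w (last xs)"
    and PS: "xs = P @ S"
  shows "0 \<le> lf_det (lcomp P) w"
proof -
  let ?a = "key w"
  obtain X Y where XY: "xs = Y @ X" "sorted (map ?a (X @ Y))"
    using ccw unfolding ccw_def cycsorted_key_iff[of w, symmetric] by (rule cycsortedE)
  have "\<exists>U V. xs = U @ V \<and> sorted (map ?a U) \<and> (\<forall>v\<in>set V. ?a v = 0)"
  proof (cases "X = [] \<or> Y = []")
    case True
    then show ?thesis using XY by (intro exI[of _ xs] exI[of _ "[]"]) auto
  next
    case False
    \<comment> \<open>In a proper rotation the last entry is a maximum of the low part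
      \<open>X\<close>, so its key is at most the first one; only key 0 remains, and all of
      \<open>X\<close> has key 0.\<close>
    then have mem: "last xs \<in> set X" "hd xs \<in> set Y" using XY(1) by auto
    then have "?a (last xs) \<le> ?a (hd xs)" using XY(2) by (auto simp: sorted_append)
    with hl have 0: "?a (last xs) = 0" by auto
    have "?a v \<le> ?a (last xs)" if "v \<in> set X" for v
      using that XY False by (cases X rule: rev_cases) (auto simp: sorted_append)
    with 0 have "\<forall>v\<in>set X. ?a v = 0" using key_bounds(1)[of w] by (metis order_antisym)
    then show ?thesis using XY by (auto simp: sorted_append)
  qed
  then obtain U V where UV: "xs = U @ V" "sorted (map ?a U)" "\<forall>v\<in>set V. ?a v = 0" by blast
  define U1 U2 where "U1 = takeWhile (\<lambda>x. ?a x \<le> pi) U" and "U2 = dropWhile (\<lambda>x. ?a x \<le> pi) U"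
  have U: "U = U1 @ U2" by (simp add: U1_def U2_def)
  have U1: "\<forall>x\<in>set U1. ?a x \<le> pi" by (auto simp: U1_def dest: set_takeWhileD)
  have U2: "\<forall>x\<in>set U2. pi < ?a x"
  proof (cases U2)
    case (Cons z F')
    then have "\<not> ?a z \<le> pi" unfolding U2_def using hd_dropWhile[of "\<lambda>x. ?a x \<le> pi" U] by force
    with UV(2) U Cons show ?thesis by (auto simp: sorted_append)
  qed simp
  have nonneg: "\<forall>x\<in>set U1. 0 \<le> lf_det x w"
    using U1 by (auto simp: lf_det_key intro!: mult_nonneg_nonneg sin_ge_zero key_bounds)
  have "lf_det x w \<le> 0" if "x \<in> set U2" for x
    using U2 that key_bounds[of w x] sin_lt_zero[of "?a x"]
    by (auto simp: lf_det_key intro!: mult_nonneg_nonpos)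
  moreover have "lf_det x w = 0" if "x \<in> set V" for x
    using UV(3) that by (simp add: lf_det_key)
  ultimately have nonpos: "\<forall>x\<in>set (U2 @ V). lf_det x w \<le> 0" by auto
  have incP: "pos_slopes P" "pos_slopes S" using inc PS by auto
  have "P @ S = U1 @ (U2 @ V)" using PS UV(1) U by simp
  \<comment> \<open>Either the prefix ends before the change of sign, or the remaining suffix begins
    after it.\<close>
  then obtain Q where "P @ Q = U1 \<and> S = Q @ U2 @ V \<or> P = U1 @ Q \<and> Q @ S = U2 @ V"
    by (auto simp: append_eq_append_conv2)
  then show ?thesis
  proof
    assume "P @ Q = U1 \<and> S = Q @ U2 @ V"
    then show ?thesis
      using nonneg by (intro lf_det_lcomp_nonneg incP) auto
  next
    assume "P = U1 @ Q \<and> Q @ S = U2 @ V"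
    then have "set S \<subseteq> set (U2 @ V)" by (metis set_append sup_ge2)
    then have "lf_det (lcomp S) w \<le> 0"
      using nonpos by (intro lf_det_lcomp_nonpos incP) auto
    moreover have "lf_det (lcomp S) w + fst (lcomp S) * lf_det (lcomp P) w = 0"
      using lf_det_self[of w] by (metis PS w lcomp_append lf_det_comp_left)
    ultimately have "0 \<le> fst (lcomp S) * lf_det (lcomp P) w" by simp
    then show ?thesis using fst_lcomp_pos[OF incP(2)] by (simp add: zero_le_mult_iff)
  qed
qed

text \<open>A minimum order \<open>ys\<close> has the composition of the sorted rotation
  \<open>X @ Y\<close> of \<open>xs\<close>, and the prefix inequality for \<open>Y\<close> shows
  that \<open>xs\<close> is no worse than this rotation.\<close>

lemma ccw_lmin:
  assumes ccw: "ccw xs" and inc: "pos_slopes xs" and nonid: "(1, 0) \<notin> set xs"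
    and nc: "noncolinear xs" and wid: "lcomp xs \<noteq> (1, 0)"
    and hl: "key (lcomp xs) (last xs) = 0 \<or> key (lcomp xs) (hd xs) < key (lcomp xs) (last xs)"
  shows "lmin xs"
proof -
  obtain ys where ys: "mset ys = mset xs" "lmin ys" using lmin_exists by blast
  then have set: "set ys = set xs" by (metis set_mset_mset)
  have ys': "pos_slopes ys" "(1, 0) \<notin> set ys" "noncolinear ys"
    using set inc nonid noncolinear_mset[OF ys(1)] nc by simp_all
  let ?w = "lcomp ys"
  have "?w \<noteq> (1, 0)"
    using ccw_id_unique[OF lmin_ccw[OF ys(2) ys'] ccw ys(1) ys'(1)] wid by blast
  then obtain U V where UV: "ys = U @ V" "sorted (map (key ?w) U)" "\<forall>v\<in>set V. key ?w v = 0"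
    using lmin_sorted[OF ys(2) ys'] by blast
  have VU: "sorted (map (key ?w) (V @ U))"
    using UV(2,3) by (auto simp: sorted_append key_bounds intro: sorted_map_const)
  \<comment> \<open>The trailing zeros point along the opposite of \<open>?w\<close>, so they
    commute with \<open>U\<close> and can be moved to the front.\<close>
  have "lf_det (lcomp V) ?w = 0"
    using UV(3) by (intro lf_det_lcomp_eq_0) (simp add: lf_det_key)
  moreover have "0 < fst (lcomp V)"
    using ys'(1) UV(1) by (intro fst_lcomp_pos) simp
  ultimately have "lf_det (lcomp V) (lcomp U) = 0"
    by (simp add: UV(1) lf_det_comp_right)
  then have eq1: "lcomp (V @ U) = ?w"
    using lf_comp_commute[of "lcomp V" "lcomp U"] by (simp add: UV(1))
  obtain X Y where XY: "xs = Y @ X" "sorted (map (key ?w) (X @ Y))"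
    using ccw unfolding ccw_def cycsorted_key_iff[of ?w, symmetric] by (rule cycsortedE)
  have eq2: "lcomp (X @ Y) = lcomp (V @ U)"
  proof (rule sorted_lcomp_eq[OF XY(2) VU])
    show "mset (X @ Y) = mset (V @ U)" using ys(1) UV(1) XY(1) by (simp add: ac_simps)
  qed (use key_eq_iff angle_eq_lf_det in blast)
  \<comment> \<open>The cut comes from sorting relative to \<open>lcomp ys\<close>, whereas this
    inequality is relative to \<open>lcomp xs\<close>; it holds for every prefix.\<close>
  have "0 \<le> lf_det (lcomp Y) (lcomp xs)"
    by (rule ccw_prefix_nonneg[OF ccw inc refl hl XY(1)])
  then have "0 \<le> lf_det (lcomp Y) (lcomp X)"
    by (simp add: XY(1) lf_det_comp_right)
  moreover have "lcomp xs = lf_comp (lcomp X) (lcomp Y)" "?w = lf_comp (lcomp Y) (lcomp X)"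
    using eq1 eq2 by (simp_all only: XY(1) lcomp_append)
  ultimately have "snd (lcomp xs) \<le> snd ?w"
    using lf_det_commutator[of "lcomp Y" "lcomp X"] by (simp del: lf_comp_simps)
  then show ?thesis
    using ys unfolding lmin_def by (metis order_trans)
qed

section \<open>Permutations and lists\<close>

text \<open>Identical functions are dropped: they change neither the composition nor the cyclic
  order of the angles.\<close>

definition seq :: "(nat \<Rightarrow> linfun) \<Rightarrow> nat \<Rightarrow> (nat \<Rightarrow> nat) \<Rightarrow> linfun list" where
  "seq f n \<sigma> = filter (\<lambda>g. g \<noteq> (1, 0)) (map (\<lambda>i. f (\<sigma> i)) [1..<Suc n])"

lemma lcomp_filter: "lcomp (filter (\<lambda>g. g \<noteq> (1, 0)) xs) = lcomp xs"
  by (induction xs) simp_all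

lemma comp_seq_eq_lcomp: "comp_seq h n = lcomp (map h [1..<Suc n])"
  by (induction n) simp_all

lemma perm_comp_eq: "perm_comp f n \<sigma> = lcomp (seq f n \<sigma>)"
  by (simp only: perm_comp_def comp_seq_eq_lcomp seq_def lcomp_filter)

lemma mset_upt_1: "mset [1..<Suc n] = mset_set {1..n}"
  by (metis atLeastLessThanSuc_atLeastAtMost mset_upt)

lemma mset_seq:
  assumes "\<sigma> permutes {1..n}"
  shows "mset (seq f n \<sigma>) = filter_mset (\<lambda>g. g \<noteq> (1, 0)) (image_mset f (mset_set {1..n}))"
proof -
  have "image_mset \<sigma> (mset_set {1..n}) = mset_set {1..n}"
    using image_mset_mset_set[OF permutes_inj_on[OF assms]] permutes_image[OF assms] by simp
  then have "image_mset f (mset_set {1..n}) = image_mset (\<lambda>i. f (\<sigma> i)) (mset_set {1..n})"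
    by (metis (no_types, lifting) comp_apply image_mset.compositionality image_mset_cong)
  then show ?thesis
    unfolding seq_def mset_filter mset_map mset_upt_1 by simp
qed

text \<open>Appending the right number of identical functions to \<open>ys\<close> gives a
  rearrangement of all the functions, which some permutation realizes.\<close>

lemma seq_surj:
  assumes "mset ys = filter_mset (\<lambda>g. g \<noteq> (1, 0)) (image_mset f (mset_set {1..n}))"
  obtains \<rho> where "\<rho> permutes {1..n}" "seq f n \<rho> = ys"
proof -
  define M where "M = image_mset f (mset_set {1..n})"
  define zs where "zs = ys @ replicate (count M (1, 0)) (1, 0)"
  have "filter_mset (\<lambda>g. \<not> g \<noteq> (1, 0)) M = replicate_mset (count M (1, 0)) (1, 0)"
    using filter_eq_replicate_mset[of "(1, 0)" M] by simp
  then have zs: "mset zs = M"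
    using assms multiset_partition[of M "\<lambda>g. g \<noteq> (1, 0)"] by (simp add: zs_def M_def)
  then have len: "length zs = n"
    by (metis M_def card_atLeastAtMost diff_Suc_1 size_image_mset size_mset size_mset_set)
  \<comment> \<open>Positions count from 1, list indices from 0.\<close>
  have map: "map (\<lambda>i. zs ! (i - 1)) [1..<Suc n] = zs"
    by (rule nth_equalityI) (simp_all add: len del: upt_Suc)
  have "image_mset (\<lambda>i. zs ! (i - 1)) (mset_set {1..n}) = M"
    unfolding mset_upt_1[symmetric] mset_map[symmetric] map zs ..
  then obtain \<rho> where \<rho>: "\<rho> permutes {1..n}" "\<forall>i\<in>{1..n}. zs ! (i - 1) = f (\<rho> i)"
    using image_mset_eq_implies_permutes[of "{1..n}" "\<lambda>i. zs ! (i - 1)" f] unfolding M_def by auto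
  have "map (\<lambda>i. f (\<rho> i)) [1..<Suc n] = zs"
    by (subst map[symmetric], rule map_cong) (use \<rho>(2) in auto)
  then have "seq f n \<rho> = filter (\<lambda>g. g \<noteq> (1, 0)) zs" by (simp only: seq_def)
  moreover have "(1, 0) \<notin> set ys"
    using assms by (metis (mono_tags, lifting) mem_Collect_eq set_mset_filter set_mset_mset)
  then have "filter (\<lambda>g. g \<noteq> (1, 0)) ys = ys" by (auto simp: filter_id_conv)
  then have "filter (\<lambda>g. g \<noteq> (1, 0)) zs = ys" by (simp add: zs_def)
  ultimately show ?thesis using \<rho>(1) that by metis
qed

lemma is_minimum_iff:
  assumes "\<sigma> permutes {1..n}"
  shows "is_minimum f n \<sigma> \<longleftrightarrow> lmin (seq f n \<sigma>)"
proof -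
  have le: "(\<forall>x. lf_app (perm_comp f n \<sigma>) x \<le> lf_app (perm_comp f n \<rho>) x) \<longleftrightarrow>
      snd (lcomp (seq f n \<sigma>)) \<le> snd (lcomp (seq f n \<rho>))" if "\<rho> permutes {1..n}" for \<rho>
  proof -
    have "mset (seq f n \<sigma>) = mset (seq f n \<rho>)" using mset_seq assms that by metis
    then have "fst (lcomp (seq f n \<sigma>)) = fst (lcomp (seq f n \<rho>))" by (simp add: fst_lcomp)
    then show ?thesis by (simp add: lf_app_def perm_comp_eq lf_alpha_def lf_beta_def)
  qed
  show ?thesis
  proof
    assume min: "is_minimum f n \<sigma>"
    show "lmin (seq f n \<sigma>)" unfolding lmin_def
    proof (intro allI impI)
      fix ys assume "mset ys = mset (seq f n \<sigma>)"
      then obtain \<rho> where "\<rho> permutes {1..n}" "seq f n \<rho> = ys"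
        using seq_surj mset_seq[OF assms] by metis
      then show "snd (lcomp (seq f n \<sigma>)) \<le> snd (lcomp ys)"
        using min le[of \<rho>] by (auto simp: is_minimum_def)
    qed
  next
    assume "lmin (seq f n \<sigma>)"
    then show "is_minimum f n \<sigma>"
      unfolding is_minimum_def lmin_def using le mset_seq assms by metis
  qed
qed

lemma lf_theta_simps [simp]:
  "lf_theta (1, 0) = None"
  "g \<noteq> (1, 0) \<Longrightarrow> lf_theta g = Some (angle g)"
  by (simp_all add: lf_theta_def lf_vec_eq_0_iff angle_def)

lemma seq_filter_map:
  "seq f n \<sigma> = map (\<lambda>i. f (\<sigma> i)) (filter (\<lambda>i. \<not> lf_identical (f (\<sigma> i))) [1..<Suc n])"
  unfolding seq_def filter_map by (simp only: lf_identical_iff comp_def)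

lemma counterclockwise_iff: "counterclockwise f n \<sigma> \<longleftrightarrow> ccw (seq f n \<sigma>)"
proof -
  have "angle_list f n \<sigma> = map angle (seq f n \<sigma>)"
    unfolding angle_list_def seq_filter_map map_map
    by (rule map_cong) (auto simp: lf_identical_iff)
  then show ?thesis by (simp add: counterclockwise_def ccw_def cycsorted_def)
qed

text \<open>The angles differ by a multiple of pi, and its parity tells the parallel from the
  antiparallel case.\<close>

lemma lf_det_eq_0_iff:
  assumes "x \<noteq> (1, 0)" "y \<noteq> (1, 0)"
  shows "lf_det x y = 0 \<longleftrightarrow> eq2pi (angle y) (angle x) \<or> eq2pi (angle y) (angle x + pi)"
proof -
  have "lf_det x y = 0 \<longleftrightarrow> (\<exists>i::int. angle y - angle x = of_int i * pi)"
    using assms by (simp add: lf_det_sin lf_vec_eq_0_iff sin_zero_iff_int2)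
  also have "\<dots> \<longleftrightarrow> eq2pi (angle y) (angle x) \<or> eq2pi (angle y) (angle x + pi)"
  proof
    assume "\<exists>i::int. angle y - angle x = of_int i * pi"
    then obtain i :: int where i: "angle y - angle x = of_int i * pi" by blast
    show "eq2pi (angle y) (angle x) \<or> eq2pi (angle y) (angle x + pi)"
    proof (cases "even i")
      case True
      then obtain j where "i = 2 * j" by blast
      then show ?thesis using i by (auto simp: eq2pi_def intro!: exI[of _ j])
    next
      case False
      then obtain j where "i = 2 * j + 1" by (rule oddE)
      then show ?thesis using i by (auto simp: eq2pi_def algebra_simps intro!: exI[of _ j])
    qed
  next
    assume "eq2pi (angle y) (angle x) \<or> eq2pi (angle y) (angle x + pi)"
    then obtain m :: int where "angle y - angle x = 2 * pi * m \<or> angle y - (angle x + pi) = 2 * pi * m"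
      by (auto simp: eq2pi_def)
    then have "angle y - angle x = of_int (2 * m) * pi \<or> angle y - angle x = of_int (2 * m + 1) * pi"
      by (auto simp: algebra_simps)
    then show "\<exists>i::int. angle y - angle x = of_int i * pi" by blast
  qed
  finally show ?thesis .
qed

section \<open>Angles modulo 2 pi and arcs\<close>

lemma eq2pi_refl [simp]: "eq2pi x x"
  unfolding eq2pi_def by (rule exI[of _ 0]) simp

lemma eq2pi_diff: "eq2pi a b \<Longrightarrow> eq2pi c d \<Longrightarrow> eq2pi (a - c) (b - d)"
  unfolding eq2pi_def
proof (elim exE)
  fix i j :: int assume "a - b = 2 * pi * i" "c - d = 2 * pi * j"
  then show "\<exists>m::int. a - c - (b - d) = 2 * pi * m"
    by (intro exI[of _ "i - j"]) (simp add: algebra_simps)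
qed

lemma eq2pi_sym: "eq2pi a b \<Longrightarrow> eq2pi b a"
  using eq2pi_diff[OF eq2pi_refl[of "a + b"], of a b] by simp

lemma eq2pi_trans: "eq2pi a b \<Longrightarrow> eq2pi b c \<Longrightarrow> eq2pi a c"
  using eq2pi_diff[of a b c b] eq2pi_sym[of b c] by (simp add: eq2pi_def)

lemma eq2pi_bounded:
  assumes "eq2pi x y" "0 \<le> x" "x < 2 * pi" "0 \<le> y" "y < 2 * pi"
  shows "x = y"
proof -
  obtain m :: int where m: "x - y = 2 * pi * m" using assms(1) by (auto simp: eq2pi_def)
  have "\<bar>2 * pi * m\<bar> < 2 * pi" using m assms(2-) by linarith
  then have "\<bar>real_of_int m\<bar> < 1" by (simp add: abs_mult)
  then have "m = 0" by linarith
  with m show ?thesis by simp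
qed

lemma eq2pi_key: "eq2pi (key w x) (angle x - anti w)"
proof -
  have "eq2pi (a + 2 * pi) a" for a unfolding eq2pi_def by (rule exI[of _ 1]) simp
  then show ?thesis by (simp add: key_def turn_def)
qed

lemma eq2pi_anti:
  assumes "w \<noteq> (1, 0)"
  shows "eq2pi (angle w + pi) (anti w)"
proof -
  have "eq2pi (a + pi) (a - pi)" for a unfolding eq2pi_def by (rule exI[of _ 1]) simp
  then show ?thesis
    using assms by (simp add: angle_def anti_def Arg2pi_minus lf_vec_eq_0_iff)
qed

text \<open>Measured from -w, an arc through -w ends at the key of \<open>s\<close> and starts at
  the key of \<open>t\<close> minus 2 pi, or at 0 if that key is 0; its length is below 2 pi exactly
  under the stated condition.\<close>

lemma arc2pi_iff:
  assumes "w \<noteq> (1, 0)"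
  shows "angle w + pi \<in> arc2pi (angle t) (angle s) \<longleftrightarrow> key w t = 0 \<or> key w s < key w t"
proof
  assume "angle w + pi \<in> arc2pi (angle t) (angle s)"
  then obtain l1 l2 l where l: "eq2pi l1 (angle t)" "eq2pi l2 (angle s)" "eq2pi l (angle w + pi)"
      "l1 \<le> l" "l \<le> l2" "l2 - l1 < 2 * pi"
    by (auto simp: arc2pi_def)
  have lw: "eq2pi l (anti w)" using eq2pi_trans[OF l(3) eq2pi_anti[OF assms]] .
  have "eq2pi (l2 - l) (key w s)"
    using eq2pi_trans[OF eq2pi_diff[OF l(2) lw] eq2pi_sym[OF eq2pi_key]] .
  then have s: "l2 - l = key w s"
    by (rule eq2pi_bounded) (use l key_bounds[of w s] in linarith)+
  have "eq2pi (l1 - l) (key w t)"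
    using eq2pi_trans[OF eq2pi_diff[OF l(1) lw] eq2pi_sym[OF eq2pi_key]] .
  moreover have "eq2pi (2 * pi) 0" unfolding eq2pi_def by (rule exI[of _ 1]) simp
  ultimately have "eq2pi (0 - (l1 - l)) (2 * pi - key w t)"
    using eq2pi_diff eq2pi_sym by blast
  then have t: "eq2pi (l - l1) (2 * pi - key w t)" by simp
  show "key w t = 0 \<or> key w s < key w t"
  proof (cases "key w t = 0")
    case False
    then have "0 < key w t" using key_bounds(1)[of w t] by simp
    then have "l - l1 = 2 * pi - key w t"
      by (intro eq2pi_bounded[OF t]) (use l key_bounds[of w t] in linarith)+
    then show ?thesis using s l by linarith
  qed simp
next
  have shift: "eq2pi (anti w + key w x) (angle x)" for x
    using eq2pi_diff[OF eq2pi_key[of w x] eq2pi_refl[of "- anti w"]] by (simp add: add.commute)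
  have w: "eq2pi (anti w) (angle w + pi)" by (rule eq2pi_sym[OF eq2pi_anti[OF assms]])
  have "eq2pi (- 2 * pi) 0" unfolding eq2pi_def by (rule exI[of _ "-1"]) simp
  then have shift': "eq2pi (anti w + key w x - 2 * pi) (angle x)" for x
    using eq2pi_diff[OF shift[of x], of "2 * pi" 0] eq2pi_diff[of 0 0 "- 2 * pi" 0] by simp
  assume "key w t = 0 \<or> key w s < key w t"
  then show "angle w + pi \<in> arc2pi (angle t) (angle s)"
  proof
    assume t: "key w t = 0"
    show ?thesis unfolding arc2pi_def mem_Collect_eq
      by (rule exI[of _ "anti w"], rule exI[of _ "anti w + key w s"], rule exI[of _ "anti w"])
        (use t key_bounds[of w s] shift w in \<open>auto simp: key_eq_0_iff\<close>)
  next
    assume t: "key w s < key w t"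
    \<comment> \<open>The start is lowered by one full turn so that it lies before -w.\<close>
    show ?thesis unfolding arc2pi_def mem_Collect_eq
      by (rule exI[of _ "anti w + key w t - 2 * pi"], rule exI[of _ "anti w + key w s"],
          rule exI[of _ "anti w"])
        (use t key_bounds[of w s] key_bounds[of w t] shift shift' w in auto)
  qed
qed

section \<open>Colinearity and the extreme positions in terms of lists\<close>

lemma colinear_iff: "colinear f n \<longleftrightarrow> \<not> noncolinear (seq f n id)"
proof -
  have set: "set (seq f n id) = {g \<in> f ` {1..n}. g \<noteq> (1, 0)}"
    by (auto simp: seq_def simp del: upt_Suc)
  show ?thesis
  proof
    assume "colinear f n"
    then obtain lam where lam: "\<And>i. i \<in> {1..n} \<Longrightarrow> f i \<noteq> (1, 0) \<Longrightarrow>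
        eq2pi (angle (f i)) lam \<or> eq2pi (angle (f i)) (lam + pi)"
      unfolding colinear_def by fastforce
    have "lf_det g h = 0" if gh: "g \<in> set (seq f n id)" "h \<in> set (seq f n id)" for g h
    proof -
      have *: "\<exists>i::int. angle k - lam = of_int i * pi" if k: "k \<in> set (seq f n id)" for k
      proof -
        have "eq2pi (angle k) lam \<or> eq2pi (angle k) (lam + pi)"
          using lam k unfolding set by blast
        then obtain m :: int where "angle k - lam = 2 * pi * m \<or> angle k - (lam + pi) = 2 * pi * m"
          by (auto simp: eq2pi_def)
        then have "angle k - lam = of_int (2 * m) * pi \<or> angle k - lam = of_int (2 * m + 1) * pi"
          by (auto simp: algebra_simps)
        then show ?thesis by blast
      qed
      obtain i j :: int where "angle g - lam = of_int i * pi" "angle h - lam = of_int j * pi"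
        using *[OF gh(1)] *[OF gh(2)] by blast
      then have "angle h - angle g = of_int (j - i) * pi" by (simp add: algebra_simps)
      then have "sin (angle h - angle g) = 0" unfolding sin_zero_iff_int2 by blast
      then show ?thesis by (simp add: lf_det_sin)
    qed
    then show "\<not> noncolinear (seq f n id)" by (auto simp: noncolinear_def)
  next
    assume nc: "\<not> noncolinear (seq f n id)"
    show "colinear f n"
    proof (cases "\<exists>i\<in>{1..n}. f i \<noteq> (1, 0)")
      case True
      \<comment> \<open>The angle of any non-identical function serves as the common
        direction.\<close>
      then obtain i where i: "i \<in> {1..n}" "f i \<noteq> (1, 0)" by blast
      have "lf_theta (f j) = None \<or> (\<exists>th. lf_theta (f j) = Some th \<and>
          (eq2pi th (angle (f i)) \<or> eq2pi th (angle (f i) + pi)))" if j: "j \<in> {1..n}" for j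
      proof (cases "f j = (1, 0)")
        case False
        then have "lf_det (f i) (f j) = 0"
          using nc i j unfolding noncolinear_def set by blast
        then show ?thesis using False lf_det_eq_0_iff[OF i(2) False] by simp
      qed simp
      then show ?thesis unfolding colinear_def by blast
    qed (simp add: colinear_def)
  qed
qed

lemma sorted_hd_last:
  fixes xs :: "'a :: linorder list"
  assumes "sorted xs" "xs \<noteq> []"
  shows "hd xs = Min (set xs)" "last xs = Max (set xs)"
proof -
  show "hd xs = Min (set xs)"
    using assms by (cases xs) (auto intro!: Min_eqI[symmetric])
  show "last xs = Max (set xs)"
    using assms by (cases xs rule: rev_cases) (auto simp: sorted_append intro!: Max_eqI[symmetric])
qed

lemma hd_last_seq:
  assumes "seq f n \<sigma> \<noteq> []"
  shows "f (\<sigma> (Min {i\<in>{1..n}. \<not> lf_identical (f (\<sigma> i))})) = hd (seq f n \<sigma>)"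
    and "f (\<sigma> (Max {i\<in>{1..n}. \<not> lf_identical (f (\<sigma> i))})) = last (seq f n \<sigma>)"
proof -
  let ?J = "filter (\<lambda>i. \<not> lf_identical (f (\<sigma> i))) [1..<Suc n]"
  have J: "?J \<noteq> []" using assms by (simp add: seq_filter_map del: upt_Suc)
  have "set ?J = {i\<in>{1..n}. \<not> lf_identical (f (\<sigma> i))}" by auto
  moreover have "sorted ?J" by (intro sorted_wrt_filter sorted_upt)
  ultimately show "f (\<sigma> (Min {i\<in>{1..n}. \<not> lf_identical (f (\<sigma> i))})) = hd (seq f n \<sigma>)"
    "f (\<sigma> (Max {i\<in>{1..n}. \<not> lf_identical (f (\<sigma> i))})) = last (seq f n \<sigma>)"
    using sorted_hd_last[of ?J] J unfolding seq_filter_map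
    by (simp_all add: hd_map last_map del: upt_Suc)
qed

text \<open>Under a constant key every list is sorted and everything is tied, so all orders have the
  same composition.\<close>

lemma not_noncolinear_lmin:
  assumes "\<not> noncolinear xs"
  shows "lmin xs"
  unfolding lmin_def
proof (intro allI impI)
  fix ys assume "mset ys = mset xs"
  then have "lcomp xs = lcomp ys"
    using assms by (intro sorted_lcomp_eq[of "\<lambda>_. 0"] sorted_map_const) (auto simp: noncolinear_def)
  then show "snd (lcomp xs) \<le> snd (lcomp ys)" by simp
qed

text \<open>Any two members can be put in front in either order, so their determinant is nonnegative
  both ways.\<close>

lemma all_lmin_not_noncolinear:
  assumes "pos_slopes xs" and all: "\<And>ys. mset ys = mset xs \<Longrightarrow> lmin ys"
  shows "\<not> noncolinear xs"
proof -
  have "0 \<le> lf_det x y" if xy: "x \<in> set xs" "y \<in> set xs" for x y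
  proof (cases "x = y")
    case False
    then have "y \<in> set (remove1 x xs)" using xy by simp
    then have "mset (x # y # remove1 y (remove1 x xs)) = mset xs"
      using xy(1) by (metis insert_DiffM mset.simps(2) mset_remove1 set_mset_mset)
    then have "lmin ([] @ [x] @ [y] @ remove1 y (remove1 x xs))" using all by simp
    moreover have "pos_slopes (remove1 y (remove1 x xs))"
      using assms(1) set_remove1_subset by (metis subsetD)
    ultimately show ?thesis
      using lmin_exchange[of "[]" "[x]" "[y]" "remove1 y (remove1 x xs)"] by simp
  qed simp
  moreover have "lf_det x y = - lf_det y x" for x y by (rule lf_det_swap)
  ultimately have "lf_det x y = 0" if "x \<in> set xs" "y \<in> set xs" for x y
    using that by (metis antisym neg_0_le_iff_le)
  then show ?thesis by (auto simp: noncolinear_def)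
qed

theorem theorem1p1:
  fixes f :: "nat \<Rightarrow> linfun" and n :: nat
  assumes mono: "\<forall>i\<in>{1..n}. lf_alpha (f i) > 0"
  shows "(colinear f n \<longleftrightarrow> (\<forall>\<sigma>. \<sigma> permutes {1..n} \<longrightarrow> is_minimum f n \<sigma>))
    \<and> (\<not> colinear f n \<longrightarrow>
           (potentially_identical f n \<longleftrightarrow>
             (\<forall>\<sigma>. \<sigma> permutes {1..n} \<longrightarrow> (is_minimum f n \<sigma> \<longleftrightarrow> counterclockwise f n \<sigma>))))
    \<and> (\<not> colinear f n \<and> \<not> potentially_identical f n \<longrightarrow>
         (\<forall>\<sigma>. \<sigma> permutes {1..n} \<longrightarrow>
           (is_minimum f n \<sigma> \<longleftrightarrow>
             (counterclockwise f n \<sigma> \<and>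
              (let s = Min {i\<in>{1..n}. \<not> lf_identical (f (\<sigma> i))};
                   t = Max {i\<in>{1..n}. \<not> lf_identical (f (\<sigma> i))}
               in \<exists>th. lf_theta (perm_comp f n \<sigma>) = Some th \<and>
                       th + pi \<in> arc2pi (the (lf_theta (f (\<sigma> t)))) (the (lf_theta (f (\<sigma> s)))))))))"
proof -
  define L where "L = seq f n"
  define M where "M = filter_mset (\<lambda>g. g \<noteq> (1, 0)) (image_mset f (mset_set {1..n}))"
  have ms: "mset (L \<sigma>) = M" if "\<sigma> permutes {1..n}" for \<sigma>
    unfolding L_def M_def by (rule mset_seq[OF that])
  have surj: "\<exists>\<rho>. \<rho> permutes {1..n} \<and> L \<rho> = ys" if "mset ys = M" for ys
    unfolding L_def using seq_surj that[unfolded M_def] by metis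
  have id: "id permutes {1..n}" by (rule permutes_id)
  have set: "set (L \<sigma>) \<subseteq> f ` {1..n} - {(1, 0)}" if "\<sigma> permutes {1..n}" for \<sigma>
    using arg_cong[OF ms[OF that], of set_mset] by (auto simp: M_def)
  have inc: "pos_slopes (L \<sigma>)" and nonid: "(1, 0) \<notin> set (L \<sigma>)" if "\<sigma> permutes {1..n}" for \<sigma>
    using set[OF that] mono by (auto simp: lf_alpha_def)
  have col: "colinear f n \<longleftrightarrow> \<not> noncolinear (L \<sigma>)" if "\<sigma> permutes {1..n}" for \<sigma>
    using colinear_iff noncolinear_mset ms[OF that] ms[OF id] unfolding L_def by metis
  have min: "is_minimum f n \<sigma> \<longleftrightarrow> lmin (L \<sigma>)" if "\<sigma> permutes {1..n}" for \<sigma>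
    unfolding L_def by (rule is_minimum_iff[OF that])
  have cc: "counterclockwise f n \<sigma> \<longleftrightarrow> ccw (L \<sigma>)" for \<sigma>
    unfolding L_def by (rule counterclockwise_iff)
  have pc: "perm_comp f n \<sigma> = lcomp (L \<sigma>)" for \<sigma>
    unfolding L_def by (rule perm_comp_eq)
  have pot: "potentially_identical f n \<longleftrightarrow>
      (\<exists>\<sigma>. \<sigma> permutes {1..n} \<and> ccw (L \<sigma>) \<and> lcomp (L \<sigma>) = (1, 0))"
    unfolding potentially_identical_def cc pc lf_identical_def[symmetric] lf_identical_iff ..
  have 1: "colinear f n \<longleftrightarrow> (\<forall>\<sigma>. \<sigma> permutes {1..n} \<longrightarrow> is_minimum f n \<sigma>)"
  proof
    assume "\<forall>\<sigma>. \<sigma> permutes {1..n} \<longrightarrow> is_minimum f n \<sigma>"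
    then have "lmin ys" if "mset ys = mset (L id)" for ys
      using surj[of ys] that min ms[OF id] by auto
    then show "colinear f n"
      using all_lmin_not_noncolinear[OF inc[OF id]] col[OF id] by blast
  qed (use min col not_noncolinear_lmin in blast)
  have 2: "potentially_identical f n \<longleftrightarrow>
      (\<forall>\<sigma>. \<sigma> permutes {1..n} \<longrightarrow> (is_minimum f n \<sigma> \<longleftrightarrow> counterclockwise f n \<sigma>))"
    if "\<not> colinear f n"
  proof
    have nc: "noncolinear (L \<sigma>)" if "\<sigma> permutes {1..n}" for \<sigma>
      using col[OF that] \<open>\<not> colinear f n\<close> by blast
    {
      assume "potentially_identical f n"
      then obtain \<rho> where \<rho>: "\<rho> permutes {1..n}" "ccw (L \<rho>)" "lcomp (L \<rho>) = (1, 0)"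
        unfolding pot by blast
      show "\<forall>\<sigma>. \<sigma> permutes {1..n} \<longrightarrow> (is_minimum f n \<sigma> \<longleftrightarrow> counterclockwise f n \<sigma>)"
      proof (intro allI impI)
        fix \<sigma> assume \<sigma>: "\<sigma> permutes {1..n}"
        \<comment> \<open>One identical counterclockwise order makes \<open>L \<sigma>\<close>
          identical, and then it is minimum.\<close>
        have "lmin (L \<sigma>)" if "ccw (L \<sigma>)"
          using ccw_id_unique[OF \<rho>(2) that _ inc[OF \<rho>(1)] \<rho>(3)] ms \<sigma> \<rho>(1)
          by (intro ccw_id_lmin that inc nonid nc) simp_all
        then show "is_minimum f n \<sigma> \<longleftrightarrow> counterclockwise f n \<sigma>"
          unfolding min[OF \<sigma>] cc using lmin_ccw[OF _ inc nonid nc] \<sigma> by blast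
      qed
    next
      assume all: "\<forall>\<sigma>. \<sigma> permutes {1..n} \<longrightarrow> (is_minimum f n \<sigma> \<longleftrightarrow> counterclockwise f n \<sigma>)"
      \<comment> \<open>A minimum order exists and is counterclockwise; since all counterclockwise
        orders are assumed minimum, its composition must be identical.\<close>
      obtain ys where "mset ys = M" "lmin ys" using lmin_exists[of "L id"] ms[OF id] by auto
      then obtain \<sigma> where \<sigma>: "\<sigma> permutes {1..n}" "lmin (L \<sigma>)" using surj by metis
      then have ccw: "ccw (L \<sigma>)" using all min cc by blast
      have "lmin ys" if "mset ys = mset (L \<sigma>)" "ccw ys" for ys
        using surj[of ys] that ms[OF \<sigma>(1)] all min cc by auto
      then have "lcomp (L \<sigma>) = (1, 0)"
        using lmin_nonid_not_all_ccw[OF \<sigma>(2) inc[OF \<sigma>(1)] nc[OF \<sigma>(1)]] ccw by blast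
      then show "potentially_identical f n" unfolding pot using \<sigma>(1) ccw by blast
    }
  qed
  have 3: "is_minimum f n \<sigma> \<longleftrightarrow> counterclockwise f n \<sigma> \<and>
      (let s = Min {i\<in>{1..n}. \<not> lf_identical (f (\<sigma> i))};
           t = Max {i\<in>{1..n}. \<not> lf_identical (f (\<sigma> i))}
       in \<exists>th. lf_theta (perm_comp f n \<sigma>) = Some th \<and>
               th + pi \<in> arc2pi (the (lf_theta (f (\<sigma> t)))) (the (lf_theta (f (\<sigma> s)))))"
    if "\<not> colinear f n" "\<not> potentially_identical f n" and \<sigma>: "\<sigma> permutes {1..n}" for \<sigma>
  proof -
    have nc: "noncolinear (L \<sigma>)" using col[OF \<sigma>] that(1) by blast
    then have ne: "L \<sigma> \<noteq> []" by (auto simp: noncolinear_def)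
    then have hl: "hd (L \<sigma>) \<noteq> (1, 0)" "last (L \<sigma>) \<noteq> (1, 0)"
      using nonid[OF \<sigma>] by (metis hd_in_set, metis last_in_set)
    let ?w = "lcomp (L \<sigma>)"
    have "lmin (L \<sigma>) \<longleftrightarrow> ccw (L \<sigma>) \<and>
        (key ?w (last (L \<sigma>)) = 0 \<or> key ?w (hd (L \<sigma>)) < key ?w (last (L \<sigma>)))"
      using lmin_ccw[of "L \<sigma>"] lmin_hd_last[of "L \<sigma>"] ccw_lmin[of "L \<sigma>"]
        inc[OF \<sigma>] nonid[OF \<sigma>] nc that(2) \<sigma> unfolding pot by blast
    \<comment> \<open>A counterclockwise composition is not identical here, so its angle is defined
      and the end condition becomes membership in the arc.\<close>
    also have "\<dots> \<longleftrightarrow> ccw (L \<sigma>) \<and> ?w \<noteq> (1, 0) \<and>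
        angle ?w + pi \<in> arc2pi (angle (last (L \<sigma>))) (angle (hd (L \<sigma>)))"
      using arc2pi_iff that(2) \<sigma> unfolding pot by blast
    finally show ?thesis
      unfolding min[OF \<sigma>] cc pc Let_def hd_last_seq[OF ne[unfolded L_def], folded L_def]
      using hl by (cases "?w = (1, 0)") simp_all
  qed
  from 1 2 3 show ?thesis by blast
qed

end
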